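(* Let $E$ be a directed graph, let $R$ be a commutative ring with identity, and let $\{p_v, s_e, s_{e^*}\}$ be the universal generating Leavitt $E$-family in the Leavitt path algebra $L_R(E)$. Let $V\subset E^0$ and set \[ M:=\operatorname{span}_R\{s_{\mu}s_{\nu^*} :\mu,\nu\in E^*,\ r(\mu)\in V\},\qquad M^*:=\operatorname{span}_R\{s_{\mu}s_{\nu^*} :\mu,\nu\in E^*,\ r(\nu)\in V\}. \] Let $MM^*$ denote the $R$-span of all products $mn$ with $m\in M$, $n\in M^*$, and $M^*M$ the $R$-span of all products $nm$ with $n\in M^*$, $m\in M$ (products taken in $L_R(E)$). Then: (1) $MM^*$ is an $R$-subalgebra of $L_R(E)$; (2) $MM^*=\operatorname{span}_R\{s_\mu s_{\nu^*}:\mu,\nu\in E^*,\ r(\mu), r(\nu)\in V\}$, and $M^*M$ is a (two-sided) ideal of $L_R(E)$ containing $MM^*$; (3) with actions given by multiplication in $L_R(E)$, $M$ is an $MM^*$--$M^*M$-bimodule and $M^*$ is an $M^*M$--$MM^*$-bimodule; (4) there are bimodule homomorphisms $\Psi: M\otimes_{M^*M}M^*\to MM^*$ with $\Psi(m\otimes n)=mn$ and $\Phi: M^*\otimes_{MM^*}M\to M^*M$ with $\Phi(n\otimes m)=nm$ such that $(MM^*, M^*M, M, M^*, \Psi,\Phi)$ is a surjective Morita context; that is, $\Psi$ and $\Phi$ are surjective and $m\,\Phi(n\otimes m')=\Psi(m\otimes n)\,m'$ and $n\,\Psi(m\otimes n')=\Phi(n\otimes m)\,n'$ for all $m,m'\in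 M$, $n,n'\in M^*$.
   Context: A directed graph $E=(E^0,E^1,r,s)$ has countable vertex set $E^0$, countable edge set $E^1$ and range and source maps $r,s:E^1\to E^0$. A vertex $v$ is singular if $r^{-1}(v)$ is empty or infinite. A finite path is a finite sequence of edges $\mu=\mu_1\cdots\mu_n$ with $s(\mu_i)=r(\mu_{i+1})$; vertices are paths of length $0$; $E^*$ is the set of finite paths; $r(\mu)=r(\mu_1)$, $s(\mu)=s(\mu_n)$ (for a vertex $v$, $r(v)=s(v)=v$). For an $R$-algebra $A$, a Leavitt $E$-family in $A$ is a set $\{P_v,S_e,S_{e^*}: v\in E^0, e\in E^1\}\subset A$ with the $P_v$ mutually orthogonal idempotents and (L1) $P_{r(e)}S_e=S_e=S_eP_{s(e)}$, $P_{s(e)}S_{e^*}=S_{e^*}=S_{e^*}P_{r(e)}$; (L2) $S_{e^*}S_f=\delta_{e,f}P_{s(e)}$; (L3) $P_v=\sum_{r(e)=v}S_eS_{e^*}$ for every non-singular $v$. The Leavitt path algebra $L_R(E)$ is the universal $R$-algebra generated by a Leavitt $E$-family $\{p_v,s_e,s_{e^*}\}$. For $\mu=\mu_1\cdots\mu_n\in E^*$, $s_\mu=s_{\mu_1}\cdots s_{\mu_n}$ and $s_{\mu^*}=s_{\mu_n^*}\cdots s_{\mu_1^*}$, with $s_v=s_{v^*}=p_v$ for a vertex $v$. *)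

theory Defs
  imports Main "HOL-Library.Poly_Mapping" "HOL-Library.Countable_Set"
begin

record ('v,'e) dgraph =
  verts :: "'v set"
  edges :: "'e set"
  rg :: "'e \<Rightarrow> 'v"
  sr :: "'e \<Rightarrow> 'v"

definition wf_graph :: "('v,'e) dgraph \<Rightarrow> bool" where
  "wf_graph G \<longleftrightarrow> countable (verts G) \<and> countable (edges G) \<and>
     (\<forall>e\<in>edges G. rg G e \<in> verts G \<and> sr G e \<in> verts G)"

definition nonsingular :: "('v,'e) dgraph \<Rightarrow> 'v \<Rightarrow> bool" where
  "nonsingular G v \<longleftrightarrow> finite {e\<in>edges G. rg G e = v} \<and> {e\<in>edges G. rg G e = v} \<noteq> {}"

datatype ('v,'e) lpath = VPath 'v | EPath "'e list"

fun is_path :: "('v,'e) dgraph \<Rightarrow> ('v,'e) lpath \<Rightarrow> bool" where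
  "is_path G (VPath v) \<longleftrightarrow> v \<in> verts G"
| "is_path G (EPath es) \<longleftrightarrow> es \<noteq> [] \<and> set es \<subseteq> edges G \<and>
     (\<forall>i. Suc i < length es \<longrightarrow> sr G (es ! i) = rg G (es ! Suc i))"

fun prange :: "('v,'e) dgraph \<Rightarrow> ('v,'e) lpath \<Rightarrow> 'v" where
  "prange G (VPath v) = v"
| "prange G (EPath es) = rg G (hd es)"

datatype ('v,'e) lgen = Pv 'v | Se 'e | Ss 'e

type_synonym ('v,'e,'r) fa = "('v,'e) lgen list \<Rightarrow>\<^sub>0 'r"

definition gens :: "('v,'e) dgraph \<Rightarrow> ('v,'e) lgen set" where
  "gens G = Pv ` verts G \<union> Se ` edges G \<union> Ss ` edges G"

definition free_alg :: "('v,'e) dgraph \<Rightarrow> ('v,'e,'r::comm_ring_1) fa set" where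
  "free_alg G = {x. \<forall>w\<in>Poly_Mapping.keys x. w \<noteq> [] \<and> set w \<subseteq> gens G}"

definition fmul :: "('v,'e,'r::comm_ring_1) fa \<Rightarrow> ('v,'e,'r) fa \<Rightarrow> ('v,'e,'r) fa" where
  "fmul x y = (\<Sum>u\<in>Poly_Mapping.keys x. \<Sum>w\<in>Poly_Mapping.keys y. Poly_Mapping.single (u @ w) (Poly_Mapping.lookup x u * Poly_Mapping.lookup y w))"

definition fsc :: "'r::comm_ring_1 \<Rightarrow> ('v,'e,'r) fa \<Rightarrow> ('v,'e,'r) fa" where
  "fsc c x = (\<Sum>w\<in>Poly_Mapping.keys x. Poly_Mapping.single w (c * Poly_Mapping.lookup x w))"

definition gen :: "('v,'e) lgen \<Rightarrow> ('v,'e,'r::comm_ring_1) fa" where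
  "gen g = Poly_Mapping.single [g] 1"

definition leavitt_rels :: "('v,'e) dgraph \<Rightarrow> ('v,'e,'r::comm_ring_1) fa set" where
  "leavitt_rels G =
     {fmul (gen (Pv v)) (gen (Pv w)) - (if v = w then gen (Pv v) else 0) | v w. v \<in> verts G \<and> w \<in> verts G}
   \<union> {fmul (gen (Pv (rg G e))) (gen (Se e)) - gen (Se e) | e. e \<in> edges G}
   \<union> {fmul (gen (Se e)) (gen (Pv (sr G e))) - gen (Se e) | e. e \<in> edges G}
   \<union> {fmul (gen (Pv (sr G e))) (gen (Ss e)) - gen (Ss e) | e. e \<in> edges G}
   \<union> {fmul (gen (Ss e)) (gen (Pv (rg G e))) - gen (Ss e) | e. e \<in> edges G}
   \<union> {fmul (gen (Ss e)) (gen (Se f)) - (if e = f then gen (Pv (sr G e)) else 0) | e f. e \<in> edges G \<and> f \<in> edges G}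
   \<union> {gen (Pv v) - (\<Sum>e\<in>{e\<in>edges G. rg G e = v}. fmul (gen (Se e)) (gen (Ss e))) | v. v \<in> verts G \<and> nonsingular G v}"

definition is_fideal :: "('v,'e) dgraph \<Rightarrow> ('v,'e,'r::comm_ring_1) fa set \<Rightarrow> bool" where
  "is_fideal G J \<longleftrightarrow> J \<subseteq> free_alg G \<and> 0 \<in> J \<and> (\<forall>x\<in>J. \<forall>y\<in>J. x + y \<in> J) \<and>
     (\<forall>c. \<forall>x\<in>J. fsc c x \<in> J) \<and> (\<forall>a\<in>free_alg G. \<forall>x\<in>J. fmul a x \<in> J \<and> fmul x a \<in> J)"

definition lideal :: "('v,'e) dgraph \<Rightarrow> ('v,'e,'r::comm_ring_1) fa set" where
  "lideal G = \<Inter>{J. is_fideal G J \<and> leavitt_rels G \<subseteq> J}"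

type_synonym ('v,'e,'r) lelem = "('v,'e,'r) fa set"

definition lcls :: "('v,'e) dgraph \<Rightarrow> ('v,'e,'r::comm_ring_1) fa \<Rightarrow> ('v,'e,'r) lelem" where
  "lcls G x = {y \<in> free_alg G. y - x \<in> lideal G}"

definition LPA :: "('v,'e) dgraph \<Rightarrow> ('v,'e,'r::comm_ring_1) lelem set" where
  "LPA G = lcls G ` free_alg G"

definition lrep :: "'a set \<Rightarrow> 'a" where
  "lrep X = (SOME x. x \<in> X)"

definition lzero :: "('v,'e) dgraph \<Rightarrow> ('v,'e,'r::comm_ring_1) lelem" where
  "lzero G = lcls G 0"

definition ladd :: "('v,'e) dgraph \<Rightarrow> ('v,'e,'r::comm_ring_1) lelem \<Rightarrow> ('v,'e,'r) lelem \<Rightarrow> ('v,'e,'r) lelem" where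
  "ladd G X Y = lcls G (lrep X + lrep Y)"

definition lmul :: "('v,'e) dgraph \<Rightarrow> ('v,'e,'r::comm_ring_1) lelem \<Rightarrow> ('v,'e,'r) lelem \<Rightarrow> ('v,'e,'r) lelem" where
  "lmul G X Y = lcls G (fmul (lrep X) (lrep Y))"

definition lsc :: "('v,'e) dgraph \<Rightarrow> 'r::comm_ring_1 \<Rightarrow> ('v,'e,'r) lelem \<Rightarrow> ('v,'e,'r) lelem" where
  "lsc G c X = lcls G (fsc c (lrep X))"

definition lneg :: "('v,'e) dgraph \<Rightarrow> ('v,'e,'r::comm_ring_1) lelem \<Rightarrow> ('v,'e,'r) lelem" where
  "lneg G X = lsc G (-1) X"

fun pword :: "('v,'e) lpath \<Rightarrow> ('v,'e) lgen list" where
  "pword (VPath v) = [Pv v]"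
| "pword (EPath es) = map Se es"

fun pword_star :: "('v,'e) lpath \<Rightarrow> ('v,'e) lgen list" where
  "pword_star (VPath v) = [Pv v]"
| "pword_star (EPath es) = map Ss (rev es)"

definition spath :: "('v,'e) dgraph \<Rightarrow> ('v,'e) lpath \<Rightarrow> ('v,'e,'r::comm_ring_1) lelem" where
  "spath G \<mu> = lcls G (Poly_Mapping.single (pword \<mu>) 1)"

definition spath_star :: "('v,'e) dgraph \<Rightarrow> ('v,'e) lpath \<Rightarrow> ('v,'e,'r::comm_ring_1) lelem" where
  "spath_star G \<mu> = lcls G (Poly_Mapping.single (pword_star \<mu>) 1)"

inductive_set lspan :: "('v,'e) dgraph \<Rightarrow> ('v,'e,'r::comm_ring_1) lelem set \<Rightarrow> ('v,'e,'r) lelem set"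
  for G S where
  lspan_zero: "lzero G \<in> lspan G S"
| lspan_gen: "x \<in> S \<Longrightarrow> x \<in> lspan G S"
| lspan_add: "x \<in> lspan G S \<Longrightarrow> y \<in> lspan G S \<Longrightarrow> ladd G x y \<in> lspan G S"
| lspan_sc: "x \<in> lspan G S \<Longrightarrow> lsc G c x \<in> lspan G S"

definition Mleft :: "('v,'e) dgraph \<Rightarrow> 'v set \<Rightarrow> ('v,'e,'r::comm_ring_1) lelem set" where
  "Mleft G V = lspan G {lmul G (spath G \<mu>) (spath_star G \<nu>) | \<mu> \<nu>.
      is_path G \<mu> \<and> is_path G \<nu> \<and> prange G \<mu> \<in> V}"

definition Mright :: "('v,'e) dgraph \<Rightarrow> 'v set \<Rightarrow> ('v,'e,'r::comm_ring_1) lelem set" where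
  "Mright G V = lspan G {lmul G (spath G \<mu>) (spath_star G \<nu>) | \<mu> \<nu>.
      is_path G \<mu> \<and> is_path G \<nu> \<and> prange G \<nu> \<in> V}"

definition lprod :: "('v,'e) dgraph \<Rightarrow> ('v,'e,'r::comm_ring_1) lelem set \<Rightarrow> ('v,'e,'r) lelem set \<Rightarrow> ('v,'e,'r) lelem set" where
  "lprod G A B = lspan G {lmul G a b | a b. a \<in> A \<and> b \<in> B}"

definition is_subalgebra :: "('v,'e) dgraph \<Rightarrow> ('v,'e,'r::comm_ring_1) lelem set \<Rightarrow> bool" where
  "is_subalgebra G A \<longleftrightarrow> A \<subseteq> LPA G \<and> lzero G \<in> A \<and> (\<forall>x\<in>A. \<forall>y\<in>A. ladd G x y \<in> A) \<and>
     (\<forall>c. \<forall>x\<in>A. lsc G c x \<in> A) \<and> (\<forall>x\<in>A. \<forall>y\<in>A. lmul G x y \<in> A)"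

definition is_ideal :: "('v,'e) dgraph \<Rightarrow> ('v,'e,'r::comm_ring_1) lelem set \<Rightarrow> bool" where
  "is_ideal G J \<longleftrightarrow> is_subalgebra G J \<and> (\<forall>a\<in>LPA G. \<forall>x\<in>J. lmul G a x \<in> J \<and> lmul G x a \<in> J)"

section \<open>Generic bimodules, tensor products and Morita contexts
  (for subsets of an ambient associative ring with operations add, mul, zero, neg)\<close>

definition is_bimod :: "('a \<Rightarrow> 'a \<Rightarrow> 'a) \<Rightarrow> ('a \<Rightarrow> 'a \<Rightarrow> 'a) \<Rightarrow> 'a \<Rightarrow> ('a \<Rightarrow> 'a) \<Rightarrow>
    'a set \<Rightarrow> 'a set \<Rightarrow> 'a set \<Rightarrow> bool" where
  "is_bimod add mul z neg A B X \<longleftrightarrow>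
     z \<in> X \<and> (\<forall>x\<in>X. \<forall>y\<in>X. add x y \<in> X) \<and> (\<forall>x\<in>X. neg x \<in> X) \<and>
     (\<forall>x\<in>X. \<forall>y\<in>X. add x y = add y x) \<and>
     (\<forall>x\<in>X. \<forall>y\<in>X. \<forall>w\<in>X. add (add x y) w = add x (add y w)) \<and>
     (\<forall>x\<in>X. add z x = x) \<and> (\<forall>x\<in>X. add (neg x) x = z) \<and>
     (\<forall>a\<in>A. \<forall>x\<in>X. mul a x \<in> X) \<and> (\<forall>b\<in>B. \<forall>x\<in>X. mul x b \<in> X) \<and>
     (\<forall>a\<in>A. \<forall>a'\<in>A. \<forall>x\<in>X. mul (mul a a') x = mul a (mul a' x)) \<and>
     (\<forall>x\<in>X. \<forall>b\<in>B. \<forall>b'\<in>B. mul x (mul b b') = mul (mul x b) b') \<and>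
     (\<forall>a\<in>A. \<forall>x\<in>X. \<forall>b\<in>B. mul (mul a x) b = mul a (mul x b)) \<and>
     (\<forall>a\<in>A. \<forall>x\<in>X. \<forall>y\<in>X. mul a (add x y) = add (mul a x) (mul a y)) \<and>
     (\<forall>a\<in>A. \<forall>a'\<in>A. \<forall>x\<in>X. mul (add a a') x = add (mul a x) (mul a' x)) \<and>
     (\<forall>b\<in>B. \<forall>x\<in>X. \<forall>y\<in>X. mul (add x y) b = add (mul x b) (mul y b)) \<and>
     (\<forall>b\<in>B. \<forall>b'\<in>B. \<forall>x\<in>X. mul x (add b b') = add (mul x b) (mul x b'))"

text \<open>Tensor product X \<otimes>_B Y: formal Z-linear combinations of pairs modulo
  the subgroup generated by biadditivity and B-balancedness.\<close>
type_synonym 'a fsum = "('a \<times> 'a) \<Rightarrow>\<^sub>0 int"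

definition fsums :: "'a set \<Rightarrow> 'a set \<Rightarrow> 'a fsum set" where
  "fsums X Y = {z. Poly_Mapping.keys z \<subseteq> X \<times> Y}"

definition tgens :: "('a \<Rightarrow> 'a \<Rightarrow> 'a) \<Rightarrow> ('a \<Rightarrow> 'a \<Rightarrow> 'a) \<Rightarrow> 'a set \<Rightarrow> 'a set \<Rightarrow> 'a set \<Rightarrow> 'a fsum set" where
  "tgens add mul X B Y =
     {Poly_Mapping.single (add x x', y) 1 - Poly_Mapping.single (x, y) 1 - Poly_Mapping.single (x', y) 1
        | x x' y. x \<in> X \<and> x' \<in> X \<and> y \<in> Y}
   \<union> {Poly_Mapping.single (x, add y y') 1 - Poly_Mapping.single (x, y) 1 - Poly_Mapping.single (x, y') 1
        | x y y'. x \<in> X \<and> y \<in> Y \<and> y' \<in> Y}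
   \<union> {Poly_Mapping.single (mul x b, y) 1 - Poly_Mapping.single (x, mul b y) 1
        | x b y. x \<in> X \<and> b \<in> B \<and> y \<in> Y}"

inductive_set tsub :: "('a \<Rightarrow> 'a \<Rightarrow> 'a) \<Rightarrow> ('a \<Rightarrow> 'a \<Rightarrow> 'a) \<Rightarrow> 'a set \<Rightarrow> 'a set \<Rightarrow> 'a set \<Rightarrow> 'a fsum set"
  for add mul X B Y where
  tsub_zero: "0 \<in> tsub add mul X B Y"
| tsub_gen: "z \<in> tgens add mul X B Y \<Longrightarrow> z \<in> tsub add mul X B Y"
| tsub_add: "z \<in> tsub add mul X B Y \<Longrightarrow> z' \<in> tsub add mul X B Y \<Longrightarrow> z + z' \<in> tsub add mul X B Y"
| tsub_neg: "z \<in> tsub add mul X B Y \<Longrightarrow> - z \<in> tsub add mul X B Y"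

definition tcls :: "('a \<Rightarrow> 'a \<Rightarrow> 'a) \<Rightarrow> ('a \<Rightarrow> 'a \<Rightarrow> 'a) \<Rightarrow> 'a set \<Rightarrow> 'a set \<Rightarrow> 'a set \<Rightarrow> 'a fsum \<Rightarrow> 'a fsum set" where
  "tcls add mul X B Y z = {z' \<in> fsums X Y. z' - z \<in> tsub add mul X B Y}"

definition tensor :: "('a \<Rightarrow> 'a \<Rightarrow> 'a) \<Rightarrow> ('a \<Rightarrow> 'a \<Rightarrow> 'a) \<Rightarrow> 'a set \<Rightarrow> 'a set \<Rightarrow> 'a set \<Rightarrow> 'a fsum set set" where
  "tensor add mul X B Y = tcls add mul X B Y ` fsums X Y"

definition tens :: "('a \<Rightarrow> 'a \<Rightarrow> 'a) \<Rightarrow> ('a \<Rightarrow> 'a \<Rightarrow> 'a) \<Rightarrow> 'a set \<Rightarrow> 'a set \<Rightarrow> 'a set \<Rightarrow> 'a \<Rightarrow> 'a \<Rightarrow> 'a fsum set" where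
  "tens add mul X B Y x y = tcls add mul X B Y (Poly_Mapping.single (x, y) 1)"

definition tadd :: "('a \<Rightarrow> 'a \<Rightarrow> 'a) \<Rightarrow> ('a \<Rightarrow> 'a \<Rightarrow> 'a) \<Rightarrow> 'a set \<Rightarrow> 'a set \<Rightarrow> 'a set \<Rightarrow> 'a fsum set \<Rightarrow> 'a fsum set \<Rightarrow> 'a fsum set" where
  "tadd add mul X B Y t t' = tcls add mul X B Y (lrep t + lrep t')"

definition tlact :: "('a \<Rightarrow> 'a \<Rightarrow> 'a) \<Rightarrow> ('a \<Rightarrow> 'a \<Rightarrow> 'a) \<Rightarrow> 'a set \<Rightarrow> 'a set \<Rightarrow> 'a set \<Rightarrow> 'a \<Rightarrow> 'a fsum set \<Rightarrow> 'a fsum set" where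
  "tlact add mul X B Y a t = tcls add mul X B Y
     (\<Sum>p\<in>Poly_Mapping.keys (lrep t). Poly_Mapping.single (mul a (fst p), snd p) (Poly_Mapping.lookup (lrep t) p))"

definition tract :: "('a \<Rightarrow> 'a \<Rightarrow> 'a) \<Rightarrow> ('a \<Rightarrow> 'a \<Rightarrow> 'a) \<Rightarrow> 'a set \<Rightarrow> 'a set \<Rightarrow> 'a set \<Rightarrow> 'a fsum set \<Rightarrow> 'a \<Rightarrow> 'a fsum set" where
  "tract add mul X B Y t a = tcls add mul X B Y
     (\<Sum>p\<in>Poly_Mapping.keys (lrep t). Poly_Mapping.single (fst p, mul (snd p) a) (Poly_Mapping.lookup (lrep t) p))"

definition tensor_mult_hom :: "('a \<Rightarrow> 'a \<Rightarrow> 'a) \<Rightarrow> ('a \<Rightarrow> 'a \<Rightarrow> 'a) \<Rightarrow> 'a set \<Rightarrow> 'a set \<Rightarrow> 'a set \<Rightarrow> 'a set \<Rightarrow>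
    ('a fsum set \<Rightarrow> 'a) \<Rightarrow> bool" where
  "tensor_mult_hom add mul A X B Y f \<longleftrightarrow>
     f ` tensor add mul X B Y \<subseteq> A \<and>
     (\<forall>x\<in>X. \<forall>y\<in>Y. f (tens add mul X B Y x y) = mul x y) \<and>
     (\<forall>t\<in>tensor add mul X B Y. \<forall>t'\<in>tensor add mul X B Y.
        f (tadd add mul X B Y t t') = add (f t) (f t')) \<and>
     (\<forall>a\<in>A. \<forall>t\<in>tensor add mul X B Y. f (tlact add mul X B Y a t) = mul a (f t)) \<and>
     (\<forall>a\<in>A. \<forall>t\<in>tensor add mul X B Y. f (tract add mul X B Y t a) = mul (f t) a)"

definition surj_morita_context :: "('a \<Rightarrow> 'a \<Rightarrow> 'a) \<Rightarrow> ('a \<Rightarrow> 'a \<Rightarrow> 'a) \<Rightarrow> 'a set \<Rightarrow> 'a set \<Rightarrow> 'a set \<Rightarrow> 'a set \<Rightarrow>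
    ('a fsum set \<Rightarrow> 'a) \<Rightarrow> ('a fsum set \<Rightarrow> 'a) \<Rightarrow> bool" where
  "surj_morita_context add mul A B M N Psi Phi \<longleftrightarrow>
     tensor_mult_hom add mul A M B N Psi \<and> tensor_mult_hom add mul B N A M Phi \<and>
     Psi ` tensor add mul M B N = A \<and> Phi ` tensor add mul N A M = B \<and>
     (\<forall>m\<in>M. \<forall>m'\<in>M. \<forall>n\<in>N.
        mul m (Phi (tens add mul N A M n m')) = mul (Psi (tens add mul M B N m n)) m') \<and>
     (\<forall>n\<in>N. \<forall>n'\<in>N. \<forall>m\<in>M.
        mul n (Psi (tens add mul M B N m n')) = mul (Phi (tens add mul N A M n m)) n')"

end

theory Submission
  imports Defs
begin

text \<open>
  Everything rests on one computation: a generator times a monomial \<open>s\<^sub>\<mu> s\<^sub>\<nu>\<^sub>*\<close> is either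
  zero or again a monomial, whose first path has the range of the generator and whose second path keeps
  its range. Iterating over the letters of a word yields, for all vertex sets \<open>W\<close> and \<open>U\<close>, that the span
  of the monomials with \<open>r(\<mu>) \<in> W\<close> times the span of those with \<open>r(\<nu>) \<in> U\<close> lies in the span of
  those with both, and that monomials span the whole algebra. The choices
  \<open>W, U \<in> {V, E\<^sup>0}\<close> give all the inclusions needed; the reverse inclusions follow from
  \<open>x = p\<^sub>v x\<close> for a monomial \<open>x\<close> whose first path has range \<open>v\<close>. The multiplication maps are
  evaluated on representatives in the free algebra, where biadditivity and balancedness hold modulo
  the Leavitt ideal.
\<close>

section \<open>The free algebra\<close>

lemma poly_mapping_sum_single:
  "(\<Sum>k\<in>Poly_Mapping.keys f. Poly_Mapping.single k (Poly_Mapping.lookup f k)) = f"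
proof (rule poly_mapping_eqI)
  fix k
  have "(\<Sum>j\<in>Poly_Mapping.keys f. Poly_Mapping.lookup f j when j = k) = Poly_Mapping.lookup f k"
    by (auto simp: when_def in_keys_iff)
  then show "Poly_Mapping.lookup
      (\<Sum>k\<in>Poly_Mapping.keys f. Poly_Mapping.single k (Poly_Mapping.lookup f k)) k
      = Poly_Mapping.lookup f k"
    by (simp add: lookup_sum lookup_single)
qed

text \<open>Every finitely supported map is the finite sum of its single-point parts. The zero map
  is \<open>single\<close> with coefficient 0, so no separate zero case arises. Multilinear
  identities thereby reduce to single words.\<close>

lemma poly_mapping_single_induct [case_names single add]:
  fixes f :: "'a \<Rightarrow>\<^sub>0 'b::comm_monoid_add"
  assumes single: "\<And>k c. P (Poly_Mapping.single k c)"
    and add: "\<And>f g. P f \<Longrightarrow> P g \<Longrightarrow> P (f + g)"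
  shows "P f"
proof -
  have zero: "P 0"
    using single[of _ 0] by simp
  have "P (\<Sum>k\<in>K. Poly_Mapping.single k (Poly_Mapping.lookup f k))" for K
    by (induction K rule: infinite_finite_induct) (auto intro: zero single add)
  from this[of "Poly_Mapping.keys f"] show ?thesis
    by (simp add: poly_mapping_sum_single)
qed

text \<open>The three sums run over different supports, since coefficients may cancel in
  \<open>x + x'\<close>. They are comparable because the summand is additive in the coefficient and
  vanishes at 0.\<close>

lemma fmul_add_left: "fmul (x + x') y = fmul x y + fmul x' y"
  unfolding fmul_def
  by (rule setsum_keys_plus_distrib
      [where f = "\<lambda>u a. \<Sum>w\<in>Poly_Mapping.keys y. Poly_Mapping.single (u @ w) (a * Poly_Mapping.lookup y w)"])
    (simp_all add: distrib_right single_add sum.distrib)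

lemma fmul_add_right: "fmul x (y + y') = fmul x y + fmul x y'"
proof -
  have "(\<Sum>w\<in>Poly_Mapping.keys (y + y'). Poly_Mapping.single (u @ w) (a * Poly_Mapping.lookup (y + y') w))
     = (\<Sum>w\<in>Poly_Mapping.keys y. Poly_Mapping.single (u @ w) (a * Poly_Mapping.lookup y w))
     + (\<Sum>w\<in>Poly_Mapping.keys y'. Poly_Mapping.single (u @ w) (a * Poly_Mapping.lookup y' w))"
    for u :: "('a, 'b) lgen list" and a :: 'c
    by (rule setsum_keys_plus_distrib[where f = "\<lambda>w b. Poly_Mapping.single (u @ w) (a * b)"])
      (simp_all add: distrib_left single_add)
  then show ?thesis
    unfolding fmul_def by (simp add: sum.distrib)
qed

lemma fmul_single_single [simp]:
  "fmul (Poly_Mapping.single u a) (Poly_Mapping.single w b) = Poly_Mapping.single (u @ w) (a * b)"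
  by (simp add: fmul_def)

lemma fmul_zero_left [simp]: "fmul 0 y = 0"
  and fmul_zero_right [simp]: "fmul x 0 = 0"
  by (simp_all add: fmul_def)

lemma fmul_sum_right: "fmul x (\<Sum>i\<in>I. f i) = (\<Sum>i\<in>I. fmul x (f i))"
  by (induction I rule: infinite_finite_induct) (simp_all add: fmul_add_right)

lemma fmul_sum_left: "fmul (\<Sum>i\<in>I. f i) x = (\<Sum>i\<in>I. fmul (f i) x)"
  by (induction I rule: infinite_finite_induct) (simp_all add: fmul_add_left)

lemma fmul_minus_left: "fmul (- x) y = - fmul x y"
  using fmul_add_left[of "- x" x y] by (simp add: eq_neg_iff_add_eq_0)

lemma fmul_minus_right: "fmul x (- y) = - fmul x y"
  using fmul_add_right[of x "- y" y] by (simp add: eq_neg_iff_add_eq_0)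

lemma fmul_diff_left: "fmul (x - x') y = fmul x y - fmul x' y"
  using fmul_add_left[of x "- x'" y] by (simp add: fmul_minus_left)

lemma fmul_diff_right: "fmul x (y - y') = fmul x y - fmul x y'"
  using fmul_add_right[of x y "- y'"] by (simp add: fmul_minus_right)

text \<open>Both sides are additive in each argument, so only words matter; there the claim is
  associativity of concatenation and of coefficient multiplication.\<close>

lemma fmul_assoc: "fmul (fmul x y) z = fmul x (fmul y z)"
proof (induction x rule: poly_mapping_single_induct)
  case (single u a)
  show ?case
  proof (induction y rule: poly_mapping_single_induct)
    case (single v b)
    show ?case
      by (induction z rule: poly_mapping_single_induct) (simp_all add: fmul_add_right mult.assoc)
  qed (simp add: fmul_add_right fmul_add_left)
qed (simp add: fmul_add_left)

lemma fsc_add: "fsc c (x + y) = fsc c x + fsc c y"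
  unfolding fsc_def
  by (rule setsum_keys_plus_distrib[where f = "\<lambda>w a. Poly_Mapping.single w (c * a)"])
    (simp_all add: distrib_left single_add)

lemma fsc_single [simp]: "fsc c (Poly_Mapping.single w a) = Poly_Mapping.single w (c * a)"
  by (simp add: fsc_def)

lemma fsc_zero [simp]: "fsc c 0 = 0"
  by (simp add: fsc_def)

lemma fsc_minus: "fsc c (- x) = - fsc c x"
  using fsc_add[of c "- x" x] by (simp add: eq_neg_iff_add_eq_0)

lemma fsc_diff: "fsc c (x - y) = fsc c x - fsc c y"
  using fsc_add[of c x "- y"] by (simp add: fsc_minus)

lemma fsc_one [simp]: "fsc 1 x = x"
  by (simp add: fsc_def poly_mapping_sum_single)

lemma fsc_add_scalar: "fsc (c + d) x = fsc c x + fsc d x"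
  by (simp add: fsc_def distrib_right single_add sum.distrib)

lemma fsc_zero_scalar [simp]: "fsc 0 x = 0"
  by (simp add: fsc_def)

lemma fsc_uminus_scalar: "fsc (- c) x = - fsc c x"
  using fsc_add_scalar[of "- c" c x] by (simp add: eq_neg_iff_add_eq_0)

lemma fsc_fsc: "fsc c (fsc d x) = fsc (c * d) x"
  by (induction x rule: poly_mapping_single_induct) (simp_all add: fsc_add mult.assoc)

lemma fmul_fsc_left: "fmul (fsc c x) y = fsc c (fmul x y)"
proof (induction x rule: poly_mapping_single_induct)
  case (single u a)
  show ?case
    by (induction y rule: poly_mapping_single_induct) (simp_all add: fmul_add_right fsc_add mult.assoc)
qed (simp add: fmul_add_left fsc_add)

lemma fmul_fsc_right: "fmul x (fsc c y) = fsc c (fmul x y)"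
proof (induction x rule: poly_mapping_single_induct)
  case (single u a)
  show ?case
    by (induction y rule: poly_mapping_single_induct)
      (simp_all add: fmul_add_right fsc_add mult.left_commute)
qed (simp add: fmul_add_left fsc_add)

lemma free_alg_zero [simp]: "0 \<in> free_alg G"
  by (simp add: free_alg_def)

lemma free_alg_add [intro]: "x \<in> free_alg G \<Longrightarrow> y \<in> free_alg G \<Longrightarrow> x + y \<in> free_alg G"
  using keys_add[of x y] by (auto simp: free_alg_def)

lemma free_alg_diff [intro]: "x \<in> free_alg G \<Longrightarrow> y \<in> free_alg G \<Longrightarrow> x - y \<in> free_alg G"
  using keys_diff[of x y] by (auto simp: free_alg_def)

lemma free_alg_sum [intro]: "(\<And>i. i \<in> I \<Longrightarrow> f i \<in> free_alg G) \<Longrightarrow> (\<Sum>i\<in>I. f i) \<in> free_alg G"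
  by (induction I rule: infinite_finite_induct) auto

lemma free_alg_single: "w \<noteq> [] \<Longrightarrow> set w \<subseteq> gens G \<Longrightarrow> Poly_Mapping.single w c \<in> free_alg G"
  by (simp add: free_alg_def)

lemma free_alg_fsc [intro]: "x \<in> free_alg G \<Longrightarrow> fsc c x \<in> free_alg G"
  unfolding fsc_def by (rule free_alg_sum, rule free_alg_single) (auto simp: free_alg_def)

lemma free_alg_fmul [intro]: "x \<in> free_alg G \<Longrightarrow> y \<in> free_alg G \<Longrightarrow> fmul x y \<in> free_alg G"
  unfolding fmul_def
  by (rule free_alg_sum, rule free_alg_sum, rule free_alg_single) (auto simp: free_alg_def)

lemma free_alg_gen [intro]: "g \<in> gens G \<Longrightarrow> gen g \<in> free_alg G"
  by (simp add: gen_def free_alg_single)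

lemma gens_simps [simp]:
  "Pv v \<in> gens G \<longleftrightarrow> v \<in> verts G" "Se e \<in> gens G \<longleftrightarrow> e \<in> edges G" "Ss e \<in> gens G \<longleftrightarrow> e \<in> edges G"
  by (auto simp: gens_def)

section \<open>The Leavitt path algebra as a quotient\<close>

text \<open>The parameter \<open>R\<close> carries no data: it pins the coefficient ring to a single type.\<close>

locale leavitt_graph =
  fixes G :: "('v,'e) dgraph" and R :: "'r::comm_ring_1 itself"
  assumes wf: "wf_graph G"
begin

section \<open>The Leavitt ideal and its residue classes\<close>

lemma rg_verts [simp]: "e \<in> edges G \<Longrightarrow> rg G e \<in> verts G"
  and sr_verts [simp]: "e \<in> edges G \<Longrightarrow> sr G e \<in> verts G"
  using wf by (auto simp: wf_graph_def)

text \<open>Together with \<open>leavitt_rels_free_alg\<close>, this makes the free algebra one of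
  the ideals intersected in \<open>lideal\<close>, which bounds that intersection.\<close>

lemma is_fideal_free_alg: "is_fideal G (free_alg G)"
  unfolding is_fideal_def by auto

lemma leavitt_rels_free_alg: "leavitt_rels G \<subseteq> free_alg G"
  unfolding leavitt_rels_def by (auto intro!: free_alg_diff free_alg_sum free_alg_fmul free_alg_gen)

lemma is_fidealD:
  assumes "is_fideal G J"
  shows "0 \<in> J"
    and "x \<in> J \<Longrightarrow> y \<in> J \<Longrightarrow> x + y \<in> J"
    and "x \<in> J \<Longrightarrow> fsc c x \<in> J"
    and "a \<in> free_alg G \<Longrightarrow> x \<in> J \<Longrightarrow> fmul a x \<in> J"
    and "a \<in> free_alg G \<Longrightarrow> x \<in> J \<Longrightarrow> fmul x a \<in> J"
  using assms unfolding is_fideal_def by blast+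

lemma is_fideal_lideal: "is_fideal G (lideal G :: ('v,'e,'s::comm_ring_1) fa set)"
proof -
  have "(lideal G :: ('v,'e,'s) fa set) \<subseteq> free_alg G"
    using is_fideal_free_alg leavitt_rels_free_alg unfolding lideal_def by blast
  then show ?thesis
    unfolding is_fideal_def[of G "lideal G :: ('v,'e,'s) fa set"]
    by (auto simp: lideal_def intro: is_fidealD)
qed

lemma leavitt_rels_lideal: "leavitt_rels G \<subseteq> lideal G"
  unfolding lideal_def by blast

lemmas lideal_zero [simp] = is_fidealD(1)[OF is_fideal_lideal]
  and lideal_add = is_fidealD(2)[OF is_fideal_lideal]
  and lideal_fsc = is_fidealD(3)[OF is_fideal_lideal]
  and lideal_fmul_left = is_fidealD(4)[OF is_fideal_lideal]
  and lideal_fmul_right = is_fidealD(5)[OF is_fideal_lideal]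

lemma lideal_uminus: "x \<in> lideal G \<Longrightarrow> - x \<in> lideal G"
  using lideal_fsc[of x "- 1"] by (simp add: fsc_uminus_scalar)

lemma lideal_diff: "x \<in> lideal G \<Longrightarrow> y \<in> lideal G \<Longrightarrow> x - y \<in> lideal G"
  using lideal_add[of x "- y"] lideal_uminus by auto

lemma lcls_eqI:
  assumes "x - y \<in> lideal G"
  shows "lcls G x = lcls G y"
proof -
  have "z - x \<in> lideal G \<longleftrightarrow> z - y \<in> lideal G" for z
    using lideal_add[OF _ assms, of "z - x"] lideal_diff[OF _ assms, of "z - y"] by auto
  then show ?thesis
    by (simp add: lcls_def)
qed

lemma lcls_eq_zeroI: "x \<in> lideal G \<Longrightarrow> lcls G x = lzero G"
  unfolding lzero_def by (rule lcls_eqI) simp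

text \<open>Classes contain only members of \<open>free_alg\<close>, so \<open>x\<close> must belong
  to it in order to lie in its own class; the converse \<open>lcls_eqI\<close> works for arbitrary
  arguments.\<close>

lemma lcls_eqD:
  assumes "lcls G x = lcls G y" "x \<in> free_alg G"
  shows "x - y \<in> lideal G"
proof -
  have "x \<in> lcls G x"
    using assms(2) by (simp add: lcls_def)
  then show ?thesis
    unfolding assms(1) by (simp add: lcls_def)
qed

lemma lrep_lcls:
  assumes "x \<in> free_alg G"
  shows "lrep (lcls G x) \<in> free_alg G" "lrep (lcls G x) - x \<in> lideal G"
proof -
  have "x \<in> lcls G x"
    using assms by (simp add: lcls_def)
  then have "lrep (lcls G x) \<in> lcls G x"
    unfolding lrep_def by (rule someI)
  then show "lrep (lcls G x) \<in> free_alg G" "lrep (lcls G x) - x \<in> lideal G"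
    by (simp_all add: lcls_def)
qed

lemma LPA_lrep:
  assumes "X \<in> LPA G"
  shows "lrep X \<in> free_alg G" "lcls G (lrep X) = X"
proof -
  obtain x where "x \<in> free_alg G" "X = lcls G x"
    using assms unfolding LPA_def by blast
  then show "lrep X \<in> free_alg G" "lcls G (lrep X) = X"
    by (simp_all add: lrep_lcls lcls_eqI)
qed

lemma LPA_cases:
  assumes "X \<in> LPA G"
  obtains x where "x \<in> free_alg G" "X = lcls G x"
  using assms unfolding LPA_def by auto

lemma lcls_LPA [simp]: "x \<in> free_alg G \<Longrightarrow> lcls G x \<in> LPA G"
  unfolding LPA_def by auto

lemma ladd_lcls:
  assumes "x \<in> free_alg G" "y \<in> free_alg G"
  shows "ladd G (lcls G x) (lcls G y) = lcls G (x + y)"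
  unfolding ladd_def
  using lideal_add[OF lrep_lcls(2)[OF assms(1)] lrep_lcls(2)[OF assms(2)]]
  by (intro lcls_eqI) (simp add: algebra_simps)

lemma lsc_lcls:
  assumes "x \<in> free_alg G"
  shows "lsc G c (lcls G x) = lcls G (fsc c x)"
  unfolding lsc_def
  using lideal_fsc[OF lrep_lcls(2)[OF assms], of c]
  by (intro lcls_eqI) (simp add: fsc_diff)

lemma lneg_lcls:
  assumes "x \<in> free_alg G"
  shows "lneg G (lcls G x) = lcls G (- x)"
  unfolding lneg_def lsc_lcls[OF assms] by (simp add: fsc_uminus_scalar)

lemma lmul_lcls:
  assumes "x \<in> free_alg G" "y \<in> free_alg G"
  shows "lmul G (lcls G x) (lcls G y) = lcls G (fmul x y)"
proof -
  let ?x = "lrep (lcls G x)" and ?y = "lrep (lcls G y)"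
  \<comment> \<open>Telescoping \<open>?x ?y - x y\<close> in this way leaves one factor in the
    ideal in each summand, so the product does not depend on the chosen representatives.\<close>
  have "fmul ?x (?y - y) + fmul (?x - x) y \<in> lideal G"
    using assms by (intro lideal_add lideal_fmul_left lideal_fmul_right lrep_lcls)
  then show ?thesis
    unfolding lmul_def by (intro lcls_eqI) (simp add: fmul_diff_left fmul_diff_right)
qed

section \<open>Algebra laws in the quotient\<close>

lemma lzero_LPA [simp]: "lzero G \<in> LPA G"
  by (simp add: lzero_def)

lemma ladd_LPA [simp]: "X \<in> LPA G \<Longrightarrow> Y \<in> LPA G \<Longrightarrow> ladd G X Y \<in> LPA G"
  by (auto elim!: LPA_cases simp: ladd_lcls intro!: lcls_LPA)

lemma lsc_LPA [simp]: "X \<in> LPA G \<Longrightarrow> lsc G c X \<in> LPA G"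
  by (auto elim!: LPA_cases simp: lsc_lcls intro!: lcls_LPA)

lemma lmul_LPA [simp]: "X \<in> LPA G \<Longrightarrow> Y \<in> LPA G \<Longrightarrow> lmul G X Y \<in> LPA G"
  by (auto elim!: LPA_cases simp: lmul_lcls intro!: lcls_LPA)

lemma ladd_commute: "X \<in> LPA G \<Longrightarrow> Y \<in> LPA G \<Longrightarrow> ladd G X Y = ladd G Y X"
  by (auto elim!: LPA_cases simp: ladd_lcls add.commute)

lemma ladd_assoc:
  "X \<in> LPA G \<Longrightarrow> Y \<in> LPA G \<Longrightarrow> Z \<in> LPA G \<Longrightarrow> ladd G (ladd G X Y) Z = ladd G X (ladd G Y Z)"
  by (auto elim!: LPA_cases simp: ladd_lcls add.assoc free_alg_add)

lemma ladd_zero_left: "X \<in> LPA G \<Longrightarrow> ladd G (lzero G) X = X"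
  by (auto elim!: LPA_cases simp: lzero_def ladd_lcls)

lemma ladd_neg_left: "X \<in> LPA G \<Longrightarrow> ladd G (lneg G X) X = lzero G"
proof (elim LPA_cases)
  fix x assume x: "x \<in> free_alg G" "X = lcls G x"
  then have "- x \<in> free_alg G"
    using free_alg_diff[of 0 G x] by simp
  with x show ?thesis
    by (simp add: lzero_def ladd_lcls lneg_lcls)
qed

lemma lmul_assoc:
  "X \<in> LPA G \<Longrightarrow> Y \<in> LPA G \<Longrightarrow> Z \<in> LPA G \<Longrightarrow> lmul G (lmul G X Y) Z = lmul G X (lmul G Y Z)"
  by (auto elim!: LPA_cases simp: lmul_lcls fmul_assoc free_alg_fmul)

lemma lmul_add_left:
  "X \<in> LPA G \<Longrightarrow> Y \<in> LPA G \<Longrightarrow> Z \<in> LPA G \<Longrightarrow>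
    lmul G (ladd G X Y) Z = ladd G (lmul G X Z) (lmul G Y Z)"
  by (auto elim!: LPA_cases simp: lmul_lcls ladd_lcls fmul_add_left free_alg_fmul free_alg_add)

lemma lmul_add_right:
  "X \<in> LPA G \<Longrightarrow> Y \<in> LPA G \<Longrightarrow> Z \<in> LPA G \<Longrightarrow>
    lmul G Z (ladd G X Y) = ladd G (lmul G Z X) (lmul G Z Y)"
  by (auto elim!: LPA_cases simp: lmul_lcls ladd_lcls fmul_add_right free_alg_fmul free_alg_add)

lemma lmul_zero_left: "X \<in> LPA G \<Longrightarrow> lmul G (lzero G) X = lzero G"
  and lmul_zero_right: "X \<in> LPA G \<Longrightarrow> lmul G X (lzero G) = lzero G"
  by (auto elim!: LPA_cases simp: lzero_def lmul_lcls)

lemma lmul_sc_left: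
  "X \<in> LPA G \<Longrightarrow> Y \<in> LPA G \<Longrightarrow> lmul G (lsc G c X) Y = lsc G c (lmul G X Y)"
  by (auto elim!: LPA_cases simp: lmul_lcls lsc_lcls fmul_fsc_left free_alg_fmul free_alg_fsc)

lemma lmul_sc_right:
  "X \<in> LPA G \<Longrightarrow> Y \<in> LPA G \<Longrightarrow> lmul G X (lsc G c Y) = lsc G c (lmul G X Y)"
  by (auto elim!: LPA_cases simp: lmul_lcls lsc_lcls fmul_fsc_right free_alg_fmul free_alg_fsc)

lemma lsc_add:
  "X \<in> LPA G \<Longrightarrow> Y \<in> LPA G \<Longrightarrow> lsc G c (ladd G X Y) = ladd G (lsc G c X) (lsc G c Y)"
  by (auto elim!: LPA_cases simp: ladd_lcls lsc_lcls fsc_add free_alg_fsc free_alg_add)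

lemma lsc_lsc: "X \<in> LPA G \<Longrightarrow> lsc G c (lsc G d X) = lsc G (c * d) X"
  by (auto elim!: LPA_cases simp: lsc_lcls fsc_fsc free_alg_fsc)

lemma lsc_one: "X \<in> LPA G \<Longrightarrow> lsc G 1 X = X"
  by (auto elim!: LPA_cases simp: lsc_lcls)

lemma lsc_zero [simp]: "lsc G c (lzero G) = lzero G"
  by (simp add: lzero_def lsc_lcls)

section \<open>Linear spans and extension from spanning sets\<close>

lemma lspan_LPA: "x \<in> lspan G S \<Longrightarrow> S \<subseteq> LPA G \<Longrightarrow> x \<in> LPA G"
  by (induction rule: lspan.induct) auto

lemma lspan_subset: "x \<in> lspan G S \<Longrightarrow> S \<subseteq> lspan G T \<Longrightarrow> x \<in> lspan G T"
  by (induction rule: lspan.induct) (auto intro: lspan.intros)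

lemma products_LPA: "X \<subseteq> LPA G \<Longrightarrow> Y \<subseteq> LPA G \<Longrightarrow> {lmul G a b | a b. a \<in> X \<and> b \<in> Y} \<subseteq> LPA G"
  by (auto intro!: lmul_LPA)

lemma lprod_LPA: "X \<subseteq> LPA G \<Longrightarrow> Y \<subseteq> LPA G \<Longrightarrow> lprod G X Y \<subseteq> LPA G"
  unfolding lprod_def using lspan_LPA products_LPA by blast

text \<open>Left multiplication by a fixed element is linear, so where it sends a span is decided on
  the spanning set.\<close>

lemma lmul_lspan_right:
  assumes "x \<in> lspan G S" "S \<subseteq> LPA G" "a \<in> LPA G" "\<And>s. s \<in> S \<Longrightarrow> lmul G a s \<in> lspan G T"
  shows "lmul G a x \<in> lspan G T"
  using assms(1)
proof (induction rule: lspan.induct)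
  case (lspan_add x y)
  then show ?case
    using assms(2,3) by (simp add: lmul_add_right lspan_LPA lspan.lspan_add)
next
  case (lspan_sc x c)
  then show ?case
    using assms(2,3) by (simp add: lmul_sc_right lspan_LPA lspan.lspan_sc)
qed (use assms in \<open>auto simp: lmul_zero_right intro: lspan.intros\<close>)

lemma lmul_lspan_left:
  assumes "x \<in> lspan G S" "S \<subseteq> LPA G" "a \<in> LPA G" "\<And>s. s \<in> S \<Longrightarrow> lmul G s a \<in> lspan G T"
  shows "lmul G x a \<in> lspan G T"
  using assms(1)
proof (induction rule: lspan.induct)
  case (lspan_add x y)
  then show ?case
    using assms(2,3) by (simp add: lmul_add_left lspan_LPA lspan.lspan_add)
next
  case (lspan_sc x c)
  then show ?case
    using assms(2,3) by (simp add: lmul_sc_left lspan_LPA lspan.lspan_sc)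
qed (use assms in \<open>auto simp: lmul_zero_left intro: lspan.intros\<close>)

lemma lcls_sum_lspan:
  assumes "\<And>i. i \<in> I \<Longrightarrow> f i \<in> free_alg G" "\<And>i. i \<in> I \<Longrightarrow> lcls G (f i) \<in> lspan G S"
  shows "lcls G (\<Sum>i\<in>I. f i) \<in> lspan G S"
  using assms
proof (induction I rule: infinite_finite_induct)
  case (insert i I)
  then have "ladd G (lcls G (f i)) (lcls G (\<Sum>i\<in>I. f i)) \<in> lspan G S"
    by (intro lspan.lspan_add) auto
  then show ?case
    using insert by (simp add: ladd_lcls free_alg_sum)
qed (auto simp: lspan.lspan_zero simp flip: lzero_def)

lemma lideal_sum: "(\<And>i. i \<in> I \<Longrightarrow> f i \<in> lideal G) \<Longrightarrow> (\<Sum>i\<in>I. f i) \<in> lideal G"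
  by (induction I rule: infinite_finite_induct) (auto intro: lideal_add)

section \<open>Monomials\<close>

text \<open>The free algebra is non-unital and excludes the empty word, hence the nonemptiness
  hypotheses on words below.\<close>

definition wcls :: "('v,'e) lgen list \<Rightarrow> ('v,'e,'r) lelem" where
  "wcls w = lcls G (Poly_Mapping.single w 1)"

text \<open>A ghost edge is read as its edge traversed backwards. With this convention (L1) and
  idempotency of the \<open>p_v\<close> become two uniform laws: each letter is fixed by the
  idempotent at its range on the left and at its source on the right.\<close>

fun gen_range :: "('v,'e) lgen \<Rightarrow> 'v" where
  "gen_range (Pv v) = v"
| "gen_range (Se e) = rg G e"
| "gen_range (Ss e) = sr G e"

fun gen_source :: "('v,'e) lgen \<Rightarrow> 'v" where
  "gen_source (Pv v) = v"
| "gen_source (Se e) = sr G e"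
| "gen_source (Ss e) = rg G e"

lemma gen_range_verts [simp]: "g \<in> gens G \<Longrightarrow> gen_range g \<in> verts G"
  and gen_source_verts [simp]: "g \<in> gens G \<Longrightarrow> gen_source g \<in> verts G"
  by (cases g; simp)+

lemma wcls_LPA [simp]: "w \<noteq> [] \<Longrightarrow> set w \<subseteq> gens G \<Longrightarrow> wcls w \<in> LPA G"
  unfolding wcls_def by (intro lcls_LPA free_alg_single)

section \<open>The Leavitt relations acting on words\<close>

lemma lmul_wcls:
  assumes "u \<noteq> []" "set u \<subseteq> gens G" "w \<noteq> []" "set w \<subseteq> gens G"
  shows "lmul G (wcls u) (wcls w) = wcls (u @ w)"
  using assms by (simp add: wcls_def lmul_lcls free_alg_single)

lemma wcls_append_cong:
  assumes "wcls u = wcls u'"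
    and "u \<noteq> []" "set u \<subseteq> gens G" "u' \<noteq> []" "set u' \<subseteq> gens G" "set w \<subseteq> gens G"
  shows "wcls (u @ w) = wcls (u' @ w)"
  using assms by (cases "w = []") (simp_all flip: lmul_wcls)

lemma wcls_append_zero:
  assumes "wcls u = lzero G"
    and "u \<noteq> []" "set u \<subseteq> gens G" "set w \<subseteq> gens G"
  shows "wcls (u @ w) = lzero G"
  using assms by (cases "w = []") (simp_all add: lmul_zero_left flip: lmul_wcls)

lemma wcls_Pv_gen:
  assumes "g \<in> gens G"
  shows "wcls [Pv (gen_range g), g] = wcls [g]"
proof -
  have "fmul (gen (Pv (gen_range g))) (gen g) - gen g \<in> leavitt_rels G"
    using assms unfolding leavitt_rels_def by (cases g) auto
  then show ?thesis
    unfolding wcls_def using leavitt_rels_lideal by (intro lcls_eqI) (auto simp: gen_def)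
qed

lemma wcls_gen_Pv:
  assumes "g \<in> gens G"
  shows "wcls [g, Pv (gen_source g)] = wcls [g]"
proof -
  have "fmul (gen g) (gen (Pv (gen_source g))) - gen g \<in> leavitt_rels G"
    using assms unfolding leavitt_rels_def by (cases g) auto
  then show ?thesis
    unfolding wcls_def using leavitt_rels_lideal by (intro lcls_eqI) (auto simp: gen_def)
qed

lemma wcls_Pv_Pv:
  assumes "v \<in> verts G" "w \<in> verts G" "v \<noteq> w"
  shows "wcls [Pv v, Pv w] = lzero G"
proof -
  have "fmul (gen (Pv v)) (gen (Pv w)) - (if v = w then gen (Pv v) else 0) \<in> leavitt_rels G"
    using assms(1,2) unfolding leavitt_rels_def by blast
  then show ?thesis
    unfolding wcls_def using leavitt_rels_lideal assms(3) by (intro lcls_eq_zeroI) (auto simp: gen_def)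
qed

lemma wcls_Ss_Se:
  assumes "e \<in> edges G" "f \<in> edges G"
  shows "wcls [Ss e, Se f] = (if e = f then wcls [Pv (sr G e)] else lzero G)"
proof -
  have "fmul (gen (Ss e) :: ('v,'e,'r) fa) (gen (Se f)) - (if e = f then gen (Pv (sr G e)) else 0) \<in> leavitt_rels G"
    using assms unfolding leavitt_rels_def by blast
  then have "fmul (gen (Ss e) :: ('v,'e,'r) fa) (gen (Se f)) - (if e = f then gen (Pv (sr G e)) else 0) \<in> lideal G"
    using leavitt_rels_lideal by blast
  then show ?thesis
    unfolding wcls_def by (simp add: gen_def lcls_eqI lcls_eq_zeroI split: if_splits)
qed

text \<open>Insert the source idempotent of \<open>g\<close> and the range idempotent of
  \<open>h\<close> between the two letters; as the vertices differ, their product vanishes.\<close>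

lemma wcls_not_composable:
  assumes "g \<in> gens G" "h \<in> gens G" "gen_source g \<noteq> gen_range h"
  shows "wcls [g, h] = lzero G"
proof -
  have "wcls [g, h] = lmul G (wcls [g]) (wcls [h])"
    using assms by (simp add: lmul_wcls)
  also have "\<dots> = lmul G (wcls [g, Pv (gen_source g)]) (wcls [Pv (gen_range h), h])"
    using assms by (simp add: wcls_Pv_gen wcls_gen_Pv)
  also have "\<dots> = wcls ([g] @ ([Pv (gen_source g), Pv (gen_range h)] @ [h]))"
    using assms by (simp add: lmul_wcls)
  also have "\<dots> = lmul G (wcls [g]) (wcls ([Pv (gen_source g), Pv (gen_range h)] @ [h]))"
    using assms by (subst lmul_wcls) auto
  also have "wcls ([Pv (gen_source g), Pv (gen_range h)] @ [h]) = lzero G"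
    using assms by (intro wcls_append_zero wcls_Pv_Pv) auto
  finally show ?thesis
    using assms by (simp add: lmul_zero_right)
qed

lemma wcls_Cons_not_composable:
  assumes "w \<noteq> []" "set (g # w) \<subseteq> gens G" "gen_source g \<noteq> gen_range (hd w)"
  shows "wcls (g # w) = lzero G"
proof (cases w)
  case (Cons h t)
  have "wcls ([g, h] @ t) = lzero G"
    using assms Cons by (intro wcls_append_zero wcls_not_composable) auto
  then show ?thesis
    using Cons by simp
qed (use assms in simp)

lemma wcls_Pv_Cons:
  assumes "w \<noteq> []" "set w \<subseteq> gens G"
  shows "wcls (Pv (gen_range (hd w)) # w) = wcls w"
proof (cases w)
  case (Cons h t)
  have "wcls ([Pv (gen_range h), h] @ t) = wcls ([h] @ t)"
    using assms Cons by (intro wcls_append_cong wcls_Pv_gen) auto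
  then show ?thesis
    using Cons by simp
qed (use assms in simp)

lemma pword_nonempty [simp]: "is_path G \<mu> \<Longrightarrow> pword \<mu> \<noteq> []" "is_path G \<mu> \<Longrightarrow> pword_star \<mu> \<noteq> []"
  and set_pword [simp]: "is_path G \<mu> \<Longrightarrow> set (pword \<mu>) \<subseteq> gens G"
    "is_path G \<mu> \<Longrightarrow> set (pword_star \<mu>) \<subseteq> gens G"
  and gen_range_hd_pword [simp]: "is_path G \<mu> \<Longrightarrow> gen_range (hd (pword \<mu>)) = prange G \<mu>"
  by (cases \<mu>; auto simp: hd_map)+

text \<open>Two parameters treat all the spans at once: \<open>V, UNIV\<close> spans
  \<open>M\<close>, \<open>UNIV, V\<close> spans \<open>M*\<close>, \<open>V, V\<close> will span
  \<open>MM*\<close>, and \<open>UNIV, UNIV\<close> the whole algebra. Sources need not match, since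
  mismatched ones only contribute zero.\<close>

definition monomials :: "'v set \<Rightarrow> 'v set \<Rightarrow> ('v,'e,'r) lelem set" where
  "monomials W U = {wcls (pword \<mu> @ pword_star \<nu>) | \<mu> \<nu>.
     is_path G \<mu> \<and> is_path G \<nu> \<and> prange G \<mu> \<in> W \<and> prange G \<nu> \<in> U}"

lemma monomials_eq:
  "{lmul G (spath G \<mu>) (spath_star G \<nu>) | \<mu> \<nu>.
     is_path G \<mu> \<and> is_path G \<nu> \<and> prange G \<mu> \<in> W \<and> prange G \<nu> \<in> U} = monomials W U"
proof -
  have "lmul G (spath G \<mu>) (spath_star G \<nu>) = wcls (pword \<mu> @ pword_star \<nu>)"
    if "is_path G \<mu>" "is_path G \<nu>" for \<mu> \<nu>
    using that by (simp add: spath_def spath_star_def lmul_wcls flip: wcls_def)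
  then show ?thesis
    unfolding monomials_def by (intro Collect_cong ex_cong1) auto
qed

lemma monomialsI:
  "is_path G \<mu> \<Longrightarrow> is_path G \<nu> \<Longrightarrow> prange G \<mu> \<in> W \<Longrightarrow> prange G \<nu> \<in> U \<Longrightarrow>
    wcls (pword \<mu> @ pword_star \<nu>) \<in> monomials W U"
  unfolding monomials_def by blast

lemma monomials_mono: "W \<subseteq> W' \<Longrightarrow> U \<subseteq> U' \<Longrightarrow> monomials W U \<subseteq> monomials W' U'"
  unfolding monomials_def by blast

lemma monomials_LPA: "monomials W U \<subseteq> LPA G"
  unfolding monomials_def by (auto intro!: wcls_LPA dest: set_pword[THEN subsetD])

lemma lspan_monomials_mono:
  "x \<in> lspan G (monomials W U) \<Longrightarrow> W \<subseteq> W' \<Longrightarrow> U \<subseteq> U' \<Longrightarrow> x \<in> lspan G (monomials W' U')"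
  using monomials_mono[of W W' U U'] by (auto elim!: lspan_subset intro: lspan.lspan_gen)

section \<open>Extending paths by an edge, and generators acting on monomials\<close>

lemma is_path_Cons:
  "is_path G (EPath (e # es)) \<longleftrightarrow>
    e \<in> edges G \<and> (es = [] \<or> is_path G (EPath es) \<and> sr G e = rg G (hd es))"
  by (cases es) (auto simp: nth_Cons split: nat.splits)

text \<open>Needed because a ghost edge multiplied onto \<open>s_{nu*}\<close> from the left
  lengthens \<open>nu\<close> at its source end.\<close>

lemma is_path_snoc:
  assumes "is_path G (EPath es)" "e \<in> edges G" "sr G (last es) = rg G e"
  shows "is_path G (EPath (es @ [e]))"
  using assms
proof (induction es)
  case (Cons f es)
  then show ?case
    by (cases "es = []") (auto simp only: is_path_Cons append_Cons hd_append2 last.simps if_False simp_thms append_Nil list.sel if_True list.distinct)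
qed simp

text \<open>If the letters do not compose, the product is zero. Otherwise
  \<open>s_{e*} s_{nu*} = s_{(nu e)*}\<close>, which leaves the range of \<open>nu\<close>
  untouched.\<close>

lemma Ss_pword_star_lspan:
  assumes e: "e \<in> edges G" and \<nu>: "is_path G \<nu>" "prange G \<nu> \<in> U"
  shows "wcls (Ss e # pword_star \<nu>) \<in> lspan G (monomials {sr G e} U)"
proof (cases "rg G e = gen_range (hd (pword_star \<nu>))")
  case False
  then have "wcls (Ss e # pword_star \<nu>) = lzero G"
    using e \<nu>(1) by (intro wcls_Cons_not_composable) auto
  then show ?thesis
    by (simp add: lspan.lspan_zero)
next
  case True
  obtain \<nu>' where \<nu>': "is_path G \<nu>'" "prange G \<nu>' = prange G \<nu>"
    and eq: "wcls (Ss e # pword_star \<nu>) = wcls (pword_star \<nu>')"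
    and hd: "hd (pword_star \<nu>') = Ss e"
  proof (cases \<nu>)
    case (VPath v)
    show ?thesis
    proof (rule that)
      \<comment> \<open>Here \<open>nu\<close> is the vertex \<open>r(e)\<close>, which
        \<open>s_{e*}\<close> absorbs, so the new path is \<open>e\<close> alone.\<close>
      show "is_path G (EPath [e])" "prange G (EPath [e]) = prange G \<nu>"
        using e True VPath by auto
      show "wcls (Ss e # pword_star \<nu>) = wcls (pword_star (EPath [e]))"
        using wcls_gen_Pv[of "Ss e"] e True VPath by simp
    qed simp
  next
    case (EPath es)
    show ?thesis
    proof (rule that)
      show "is_path G (EPath (es @ [e]))"
        using e True EPath \<nu>(1) by (intro is_path_snoc) (auto simp: hd_map hd_rev)
    qed (use EPath \<nu>(1) in auto)
  qed
  \<comment> \<open>The first letter is now \<open>s_{e*}\<close>, whose range is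
    \<open>s(e)\<close>; prefixing \<open>p_{s(e)}\<close> supplies the missing first path of a
    monomial.\<close>
  then have "wcls (Ss e # pword_star \<nu>) = wcls (pword (VPath (sr G e)) @ pword_star \<nu>')"
    using wcls_Pv_Cons[of "pword_star \<nu>'"] \<nu>'(1) by simp
  moreover have "wcls (pword (VPath (sr G e)) @ pword_star \<nu>') \<in> monomials {sr G e} U"
    using e \<nu> \<nu>' by (intro monomialsI) auto
  ultimately show ?thesis
    by (simp only: lspan.lspan_gen)
qed

text \<open>Unless the product vanishes for lack of composability, a vertex is absorbed and an edge
  lengthens \<open>mu\<close>. A ghost edge meets the first edge of \<open>mu\<close> through (L2),
  or passes on to \<open>nu\<close> when \<open>mu\<close> is a vertex.\<close>

lemma gen_monomial_lspan:
  assumes g: "g \<in> gens G" and \<mu>: "is_path G \<mu>" and \<nu>: "is_path G \<nu>" "prange G \<nu> \<in> U"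
  shows "wcls (g # pword \<mu> @ pword_star \<nu>) \<in> lspan G (monomials {gen_range g} U)"
proof (cases "gen_source g = prange G \<mu>")
  case False
  then have "wcls (g # pword \<mu> @ pword_star \<nu>) = lzero G"
    using g \<mu> \<nu>(1) by (intro wcls_Cons_not_composable) auto
  then show ?thesis
    by (simp add: lspan.lspan_zero)
next
  case True
  have absorb: "wcls (Pv (prange G \<mu>) # pword \<mu> @ pword_star \<nu>) = wcls (pword \<mu> @ pword_star \<nu>)"
    if "is_path G \<mu>" for \<mu>
    using wcls_Pv_Cons[of "pword \<mu> @ pword_star \<nu>"] that \<nu>(1) by simp
  show ?thesis
  proof (cases g)
    case (Pv v)
    then show ?thesis
      using True absorb[OF \<mu>] \<mu> \<nu> by (auto intro!: lspan.lspan_gen monomialsI)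
  next
    case (Se e)
    obtain \<mu>' where \<mu>': "is_path G \<mu>'" "prange G \<mu>' = rg G e"
      and eq: "wcls (g # pword \<mu> @ pword_star \<nu>) = wcls (pword \<mu>' @ pword_star \<nu>)"
    proof (cases \<mu>)
      case (VPath v)
      have "wcls ([Se e, Pv (sr G e)] @ pword_star \<nu>) = wcls ([Se e] @ pword_star \<nu>)"
        using g Se \<nu>(1) wcls_gen_Pv[of "Se e"] by (intro wcls_append_cong) auto
      then show ?thesis
        using VPath Se g True by (intro that[of "EPath [e]"]) auto
    next
      case (EPath es)
      then show ?thesis
        using Se g True \<mu> is_path_Cons[of e es] by (intro that[of "EPath (e # es)"]) auto
    qed
    then show ?thesis
      using Se \<nu> by (auto intro!: lspan.lspan_gen monomialsI)
  next
    case (Ss e)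
    then have e: "e \<in> edges G"
      using g by simp
    show ?thesis
    proof (cases \<mu>)
      case (VPath v)
      \<comment> \<open>The vertex \<open>mu\<close> equals \<open>r(e)\<close> and disappears into
        \<open>s_{e*}\<close>, so the ghost edge now acts directly on \<open>nu\<close>.\<close>
      have "wcls ([Ss e, Pv (rg G e)] @ pword_star \<nu>) = wcls ([Ss e] @ pword_star \<nu>)"
        using e \<nu>(1) wcls_gen_Pv[of "Ss e"] by (intro wcls_append_cong) auto
      then show ?thesis
        using VPath Ss True Ss_pword_star_lspan[OF e \<nu>] by simp
    next
      case (EPath es)
      then obtain f fs where es: "es = f # fs" "f \<in> edges G" "set fs \<subseteq> edges G"
        using \<mu> by (cases es) auto
      have gens: "set (map Se fs @ pword_star \<nu>) \<subseteq> gens G"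
        using es \<nu>(1) set_pword(2) by auto
      show ?thesis
      proof (cases "e = f")
        case False
        have "wcls ([Ss e, Se f] @ map Se fs @ pword_star \<nu>) = lzero G"
          using e es False gens by (intro wcls_append_zero) (auto simp: wcls_Ss_Se)
        then show ?thesis
          using EPath es Ss by (simp add: lspan.lspan_zero)
      next
        case True
        have "wcls ([Ss e, Se f] @ map Se fs @ pword_star \<nu>)
            = wcls ([Pv (sr G e)] @ map Se fs @ pword_star \<nu>)"
          using e es True gens by (intro wcls_append_cong) (auto simp: wcls_Ss_Se)
        then have eq: "wcls (g # pword \<mu> @ pword_star \<nu>)
            = wcls (Pv (sr G e) # map Se fs @ pword_star \<nu>)"
          using EPath es Ss by simp
        \<comment> \<open>After the cancellation the new first path is the tail of
          \<open>mu\<close>, whose range is \<open>s(e)\<close> by composability; if the tail is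
          empty, the vertex \<open>s(e)\<close> takes its place.\<close>
        obtain \<mu>' where \<mu>': "is_path G \<mu>'" "prange G \<mu>' = sr G e"
          and eq': "wcls (Pv (sr G e) # map Se fs @ pword_star \<nu>) = wcls (pword \<mu>' @ pword_star \<nu>)"
        proof (cases "fs = []")
          case fs: True
          then show ?thesis
            using e by (intro that[of "VPath (sr G e)"]) auto
        next
          case fs: False
          then have "is_path G (EPath fs)" "sr G e = rg G (hd fs)"
            using \<mu> is_path_Cons[of f fs] EPath es True by auto
          then show ?thesis
            using absorb[of "EPath fs"] by (intro that[of "EPath fs"]) auto
        qed
        show ?thesis
          unfolding eq eq' using Ss \<mu>' \<nu> by (auto intro!: lspan.lspan_gen monomialsI)
      qed
    qed
  qed
qed

section \<open>From generators to words and products of spans\<close>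

lemma gen_lspan_monomials:
  assumes g: "g \<in> gens G" and x: "x \<in> lspan G (monomials UNIV U)"
  shows "lmul G (wcls [g]) x \<in> lspan G (monomials {gen_range g} U)"
proof (rule lmul_lspan_right[OF x monomials_LPA])
  fix s assume "s \<in> monomials UNIV U"
  then obtain \<mu> \<nu> where s: "s = wcls (pword \<mu> @ pword_star \<nu>)"
    and p: "is_path G \<mu>" "is_path G \<nu>" "prange G \<nu> \<in> U"
    unfolding monomials_def by auto
  then have "lmul G (wcls [g]) s = wcls (g # pword \<mu> @ pword_star \<nu>)"
    using g by (simp add: lmul_wcls)
  then show "lmul G (wcls [g]) s \<in> lspan G (monomials {gen_range g} U)"
    using gen_monomial_lspan[OF g p] by simp
qed (use g in simp)

text \<open>Letters act one at a time from right to left. The range produced by the inner letters is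
  forgotten by enlarging to \<open>UNIV\<close>; only the leftmost letter determines the final
  one.\<close>

lemma word_lspan_monomials:
  assumes "w \<noteq> []" "set w \<subseteq> gens G" and x: "x \<in> lspan G (monomials UNIV U)"
  shows "lmul G (wcls w) x \<in> lspan G (monomials {gen_range (hd w)} U)"
  using assms(1,2)
proof (induction w rule: list_nonempty_induct)
  case (single g)
  then show ?case
    using gen_lspan_monomials x by simp
next
  case (cons g w)
  then have "lmul G (wcls w) x \<in> lspan G (monomials UNIV U)"
    by (auto elim: lspan_monomials_mono)
  then have "lmul G (wcls [g]) (lmul G (wcls w) x) \<in> lspan G (monomials {gen_range g} U)"
    using cons by (intro gen_lspan_monomials) auto
  moreover have "lmul G (lmul G (wcls [g]) (wcls w)) x = lmul G (wcls [g]) (lmul G (wcls w) x)"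
    using cons lspan_LPA[OF x monomials_LPA] by (intro lmul_assoc) auto
  ultimately show ?case
    using cons by (simp add: lmul_wcls)
qed

text \<open>A monomial on the left is itself a word whose first letter has range in
  \<open>W\<close>, and letting it act on \<open>b\<close> preserves the condition \<open>U\<close>
  on the second path.\<close>

lemma lmul_lspan_monomials:
  assumes a: "a \<in> lspan G (monomials W UNIV)" and b: "b \<in> lspan G (monomials UNIV U)"
  shows "lmul G a b \<in> lspan G (monomials W U)"
proof (rule lmul_lspan_left[OF a monomials_LPA])
  show "b \<in> LPA G"
    using b monomials_LPA by (rule lspan_LPA)
  fix s assume "s \<in> monomials W UNIV"
  then obtain \<mu> \<nu> where s: "s = wcls (pword \<mu> @ pword_star \<nu>)"
    and p: "is_path G \<mu>" "is_path G \<nu>" "prange G \<mu> \<in> W"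
    unfolding monomials_def by auto
  have "lmul G s b \<in> lspan G (monomials {prange G \<mu>} U)"
    using word_lspan_monomials[of "pword \<mu> @ pword_star \<nu>", OF _ _ b] p s by simp
  then show "lmul G s b \<in> lspan G (monomials W U)"
    by (rule lspan_monomials_mono) (use p in auto)
qed

lemma Pv_monomials:
  assumes "v \<in> verts G" "v \<in> W" "v \<in> U"
  shows "wcls [Pv v] \<in> monomials W U"
proof -
  have "wcls (pword (VPath v) @ pword_star (VPath v)) \<in> monomials W U"
    by (rule monomialsI) (use assms in auto)
  then show ?thesis
    using wcls_Pv_gen[of "Pv v"] assms by simp
qed

lemma Pv_lmul_monomial:
  assumes "x \<in> monomials W U"
  obtains v where "v \<in> verts G" "v \<in> W" "lmul G (wcls [Pv v]) x = x"
proof -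
  obtain \<mu> \<nu> where x: "x = wcls (pword \<mu> @ pword_star \<nu>)"
    and p: "is_path G \<mu>" "is_path G \<nu>" "prange G \<mu> \<in> W"
    using assms unfolding monomials_def by auto
  have v: "prange G \<mu> \<in> verts G"
    using p(1) by (cases \<mu>) (auto simp: subset_iff intro: rg_verts)
  then have "lmul G (wcls [Pv (prange G \<mu>)]) x = x"
    using wcls_Pv_Cons[of "pword \<mu> @ pword_star \<nu>"] p unfolding x by (simp add: lmul_wcls)
  then show ?thesis
    using that v p by blast
qed

lemma LPA_eq_lspan_monomials:
  "LPA G = lspan G (monomials UNIV UNIV)"
proof
  have word: "wcls w \<in> lspan G (monomials UNIV UNIV)"
    if "w \<noteq> []" "set w \<subseteq> gens G" for w
    using that
  proof (induction w rule: list_nonempty_induct)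
    case (single g)
    \<comment> \<open>A single letter is itself times its source idempotent, and
      \<open>p_v = p_v p_v\<close> is already a monomial.\<close>
    then have "lmul G (wcls [g]) (wcls [Pv (gen_source g)])
        \<in> lspan G (monomials {gen_range g} UNIV)"
      by (intro gen_lspan_monomials lspan.lspan_gen Pv_monomials) auto
    then have "wcls [g] \<in> lspan G (monomials {gen_range g} UNIV)"
      using single by (simp add: lmul_wcls wcls_gen_Pv)
    then show ?case
      by (rule lspan_monomials_mono) auto
  next
    case (cons g w)
    then have "lmul G (wcls [g]) (wcls w) \<in> lspan G (monomials {gen_range g} UNIV)"
      by (intro gen_lspan_monomials) auto
    then have "wcls (g # w) \<in> lspan G (monomials {gen_range g} UNIV)"
      using cons by (simp add: lmul_wcls)
    then show ?case
      by (rule lspan_monomials_mono) auto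
  qed
  show "LPA G \<subseteq> lspan G (monomials UNIV UNIV)"
  proof
    fix X :: "('v,'e,'r) lelem" assume "X \<in> LPA G"
    then obtain x where x: "x \<in> free_alg G" "X = lcls G x"
      by (rule LPA_cases)
    have w: "w \<noteq> []" "set w \<subseteq> gens G" if "w \<in> Poly_Mapping.keys x" for w
      using that x unfolding free_alg_def by auto
    have "lcls G (\<Sum>w\<in>Poly_Mapping.keys x. fsc (Poly_Mapping.lookup x w) (Poly_Mapping.single w 1))
        \<in> lspan G (monomials UNIV UNIV)"
    proof (rule lcls_sum_lspan)
      fix v assume v: "v \<in> Poly_Mapping.keys x"
      show "fsc (Poly_Mapping.lookup x v) (Poly_Mapping.single v 1) \<in> free_alg G"
        using w[OF v] by (intro free_alg_fsc free_alg_single)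
      have "lsc G (Poly_Mapping.lookup x v) (wcls v) \<in> lspan G (monomials UNIV UNIV)"
        using word w[OF v] by (intro lspan.lspan_sc)
      then show "lcls G (fsc (Poly_Mapping.lookup x v) (Poly_Mapping.single v 1))
          \<in> lspan G (monomials UNIV UNIV)"
        by (simp only: wcls_def lsc_lcls[OF free_alg_single[OF w[OF v]]])
    qed
    then show "X \<in> lspan G (monomials UNIV UNIV)"
      using x by (simp add: poly_mapping_sum_single)
  qed
qed (auto intro: lspan_LPA[OF _ monomials_LPA])

section \<open>Multiplication maps on tensor products\<close>

text \<open>Evaluates a formal sum before passing to the quotient: sums in the free algebra are
  genuine group sums, so additivity holds exactly, and only the tensor relations have to be checked
  modulo the ideal.\<close>

definition tev :: "('v,'e,'r) lelem fsum \<Rightarrow> ('v,'e,'r) fa" where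
  "tev z = (\<Sum>p\<in>Poly_Mapping.keys z.
     fsc (of_int (Poly_Mapping.lookup z p)) (fmul (lrep (fst p)) (lrep (snd p))))"

text \<open>It mentions neither the factors nor the middle ring, so the same map serves as both
  \<open>Psi\<close> and \<open>Phi\<close>.\<close>

definition tmult :: "('v,'e,'r) lelem fsum set \<Rightarrow> ('v,'e,'r) lelem" where
  "tmult t = lcls G (tev (lrep t))"

lemma tev_add: "tev (y + z) = tev y + tev z"
  unfolding tev_def
  by (rule setsum_keys_plus_distrib
      [where f = "\<lambda>p c. fsc (of_int c) (fmul (lrep (fst p)) (lrep (snd p)))"])
    (simp_all add: fsc_add_scalar)

lemma tev_single [simp]:
  "tev (Poly_Mapping.single p c) = fsc (of_int c) (fmul (lrep (fst p)) (lrep (snd p)))"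
  by (simp add: tev_def)

lemma tev_zero [simp]: "tev 0 = 0"
  by (simp add: tev_def)

lemma tev_uminus: "tev (- z) = - tev z"
  using tev_add[of "- z" z] by (simp add: eq_neg_iff_add_eq_0)

lemma tev_diff: "tev (y - z) = tev y - tev z"
  using tev_add[of y "- z"] by (simp add: tev_uminus)

lemma tev_sum: "tev (\<Sum>i\<in>I. f i) = (\<Sum>i\<in>I. tev (f i))"
  by (induction I rule: infinite_finite_induct) (simp_all add: tev_add)

lemma fmul_lrep_free_alg: "x \<in> LPA G \<Longrightarrow> y \<in> LPA G \<Longrightarrow> fmul (lrep x) (lrep y) \<in> free_alg G"
  by (intro free_alg_fmul LPA_lrep)

lemma tev_free_alg:
  assumes "X \<subseteq> LPA G" "Y \<subseteq> LPA G" "z \<in> fsums X Y"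
  shows "tev z \<in> free_alg G"
  unfolding tev_def using assms
  by (auto simp: fsums_def intro!: free_alg_sum free_alg_fsc fmul_lrep_free_alg)

lemma lcls_fmul_lrep_eqD:
  assumes "lcls G (fmul (lrep x) (lrep y)) = lcls G z" "x \<in> LPA G" "y \<in> LPA G"
  shows "fmul (lrep x) (lrep y) - z \<in> lideal G"
  by (rule lcls_eqD[OF assms(1) fmul_lrep_free_alg[OF assms(2,3)]])

text \<open>The three kinds of relators evaluate to zero in the quotient by left distributivity,
  right distributivity and associativity; equality of classes then places the difference of
  representatives in the ideal.\<close>

lemma tev_tgens:
  assumes "X \<subseteq> LPA G" "B \<subseteq> LPA G" "Y \<subseteq> LPA G" "z \<in> tgens (ladd G) (lmul G) X B Y"
  shows "tev z \<in> lideal G"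
proof -
  consider x x' y where "z = Poly_Mapping.single (ladd G x x', y) 1 - Poly_Mapping.single (x, y) 1
        - Poly_Mapping.single (x', y) 1" "x \<in> X" "x' \<in> X" "y \<in> Y"
    | x y y' where "z = Poly_Mapping.single (x, ladd G y y') 1 - Poly_Mapping.single (x, y) 1
        - Poly_Mapping.single (x, y') 1" "x \<in> X" "y \<in> Y" "y' \<in> Y"
    | x b y where "z = Poly_Mapping.single (lmul G x b, y) 1 - Poly_Mapping.single (x, lmul G b y) 1"
        "x \<in> X" "b \<in> B" "y \<in> Y"
    using assms(4) unfolding tgens_def by blast
  then show ?thesis
  proof cases
    case (1 x x' y)
    then have m: "x \<in> LPA G" "x' \<in> LPA G" "y \<in> LPA G"
      using assms by auto
    have "lmul G (ladd G x x') y = ladd G (lmul G x y) (lmul G x' y)"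
      using m by (simp add: lmul_add_left)
    then have "lcls G (fmul (lrep (ladd G x x')) (lrep y))
        = lcls G (fmul (lrep x) (lrep y) + fmul (lrep x') (lrep y))"
      using m by (simp add: lmul_def ladd_lcls fmul_lrep_free_alg)
    from lcls_fmul_lrep_eqD[OF this] m show ?thesis
      unfolding 1(1) tev_diff tev_single by (simp add: diff_diff_eq)
  next
    case (2 x y y')
    then have m: "x \<in> LPA G" "y \<in> LPA G" "y' \<in> LPA G"
      using assms by auto
    have "lmul G x (ladd G y y') = ladd G (lmul G x y) (lmul G x y')"
      using m by (simp add: lmul_add_right)
    then have "lcls G (fmul (lrep x) (lrep (ladd G y y')))
        = lcls G (fmul (lrep x) (lrep y) + fmul (lrep x) (lrep y'))"
      using m by (simp add: lmul_def ladd_lcls fmul_lrep_free_alg)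
    from lcls_fmul_lrep_eqD[OF this] m show ?thesis
      unfolding 2(1) tev_diff tev_single by (simp add: diff_diff_eq)
  next
    case (3 x b y)
    then have m: "x \<in> LPA G" "b \<in> LPA G" "y \<in> LPA G"
      using assms by auto
    have "lmul G (lmul G x b) y = lmul G x (lmul G b y)"
      using m by (simp add: lmul_assoc)
    then have "lcls G (fmul (lrep (lmul G x b)) (lrep y)) = lcls G (fmul (lrep x) (lrep (lmul G b y)))"
      by (simp only: lmul_def[of G "lmul G x b"] lmul_def[of G x "lmul G b y"])
    from lcls_fmul_lrep_eqD[OF this] m show ?thesis
      unfolding 3(1) by (simp add: tev_diff)
  qed
qed

lemma tev_tsub:
  assumes "X \<subseteq> LPA G" "B \<subseteq> LPA G" "Y \<subseteq> LPA G" "z \<in> tsub (ladd G) (lmul G) X B Y"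
  shows "tev z \<in> lideal G"
  using assms(4)
proof (induction rule: tsub.induct)
  case (tsub_gen z)
  then show ?case
    using assms(1-3) by (rule tev_tgens[rotated 3])
qed (simp_all add: tev_add tev_uminus lideal_add lideal_uminus)

lemma lrep_tcls:
  assumes "z \<in> fsums X Y"
  shows "lrep (tcls (ladd G) (lmul G) X B Y z) \<in> fsums X Y"
    and "lrep (tcls (ladd G) (lmul G) X B Y z) - z \<in> tsub (ladd G) (lmul G) X B Y"
proof -
  let ?t = "tcls (ladd G) (lmul G) X B Y z"
  have "z \<in> ?t"
    using assms by (simp add: tcls_def tsub.tsub_zero)
  then have "lrep ?t \<in> ?t"
    unfolding lrep_def by (rule someI)
  then show "lrep ?t \<in> fsums X Y" "lrep ?t - z \<in> tsub (ladd G) (lmul G) X B Y"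
    by (simp_all add: tcls_def)
qed

text \<open>Well-definedness on the tensor product: the chosen representative differs from
  \<open>z\<close> by an element of \<open>tsub\<close>, which \<open>tev\<close> sends into the
  Leavitt ideal.\<close>

lemma tmult_tcls:
  assumes "X \<subseteq> LPA G" "B \<subseteq> LPA G" "Y \<subseteq> LPA G" "z \<in> fsums X Y"
  shows "tmult (tcls (ladd G) (lmul G) X B Y z) = lcls G (tev z)"
  unfolding tmult_def
  using tev_tsub[OF assms(1-3) lrep_tcls(2)[OF assms(4)]]
  by (intro lcls_eqI) (simp add: tev_diff)

lemma fsums_add: "y \<in> fsums X Y \<Longrightarrow> z \<in> fsums X Y \<Longrightarrow> y + z \<in> fsums X Y"
  using keys_add[of y z] by (auto simp: fsums_def)

lemma fsums_sum: "(\<And>i. i \<in> I \<Longrightarrow> f i \<in> fsums X Y) \<Longrightarrow> (\<Sum>i\<in>I. f i) \<in> fsums X Y"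
  by (induction I rule: infinite_finite_induct) (auto simp: fsums_add, simp_all add: fsums_def)

lemma fsums_single: "x \<in> X \<Longrightarrow> y \<in> Y \<Longrightarrow> Poly_Mapping.single (x, y) c \<in> fsums X Y"
  by (simp add: fsums_def)

text \<open>The integer coefficients of a formal sum act as scalars through \<open>of_int\<close>,
  so its value is an \<open>R\<close>-combination of products.\<close>

lemma lcls_tev_lprod:
  assumes "X \<subseteq> LPA G" "Y \<subseteq> LPA G" "z \<in> fsums X Y"
  shows "lcls G (tev z) \<in> lprod G X Y"
  unfolding tev_def lprod_def
proof (rule lcls_sum_lspan)
  fix p assume "p \<in> Poly_Mapping.keys z"
  then have p: "fst p \<in> X" "snd p \<in> Y"
    using assms(3) by (auto simp: fsums_def)
  let ?f = "fmul (lrep (fst p)) (lrep (snd p))"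
  have free: "?f \<in> free_alg G"
    using p assms by (intro fmul_lrep_free_alg) auto
  then show "fsc (of_int (Poly_Mapping.lookup z p)) ?f \<in> free_alg G"
    by (rule free_alg_fsc)
  have "lsc G (of_int (Poly_Mapping.lookup z p)) (lcls G ?f) \<in> lspan G {lmul G a b |a b. a \<in> X \<and> b \<in> Y}"
    using p by (intro lspan.lspan_sc lspan.lspan_gen) (auto simp: lmul_def)
  then show "lcls G (fsc (of_int (Poly_Mapping.lookup z p)) ?f) \<in> lspan G {lmul G a b |a b. a \<in> X \<and> b \<in> Y}"
    by (simp only: lsc_lcls[OF free])
qed

lemma tmult_tens:
  assumes "X \<subseteq> LPA G" "B \<subseteq> LPA G" "Y \<subseteq> LPA G" "x \<in> X" "y \<in> Y"
  shows "tmult (tens (ladd G) (lmul G) X B Y x y) = lmul G x y"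
  unfolding tens_def using assms(4,5) by (simp add: tmult_tcls[OF assms(1-3)] fsums_single lmul_def)

text \<open>\<open>AX\<close> and \<open>YA\<close> keep the outer actions inside formal sums over
  \<open>X\<close> and \<open>Y\<close>; compatibility with them is then associativity applied to
  each summand.\<close>

lemma tensor_mult_hom_tmult:
  assumes LPA: "X \<subseteq> LPA G" "B \<subseteq> LPA G" "Y \<subseteq> LPA G"
    and AX: "\<And>a x. a \<in> lprod G X Y \<Longrightarrow> x \<in> X \<Longrightarrow> lmul G a x \<in> X"
    and YA: "\<And>a y. a \<in> lprod G X Y \<Longrightarrow> y \<in> Y \<Longrightarrow> lmul G y a \<in> Y"
  shows "tensor_mult_hom (ladd G) (lmul G) (lprod G X Y) X B Y tmult"
proof -
  have A: "lprod G X Y \<subseteq> LPA G"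
    using LPA by (intro lprod_LPA)
  have rep: "lrep t \<in> fsums X Y" if "t \<in> tensor (ladd G) (lmul G) X B Y" for t
    using that lrep_tcls(1) by (auto simp: tensor_def)
  have rep_free: "tev (lrep t) \<in> free_alg G" if "t \<in> tensor (ladd G) (lmul G) X B Y" for t
    using tev_free_alg LPA rep[OF that] by blast
  have add: "tmult (tadd (ladd G) (lmul G) X B Y t t') = ladd G (tmult t) (tmult t')"
    if "t \<in> tensor (ladd G) (lmul G) X B Y" "t' \<in> tensor (ladd G) (lmul G) X B Y" for t t'
    using that unfolding tadd_def tmult_tcls[OF LPA fsums_add[OF rep[OF that(1)] rep[OF that(2)]]]
    by (simp add: tev_add tmult_def ladd_lcls rep_free)
  have left: "tmult (tlact (ladd G) (lmul G) X B Y a t) = lmul G a (tmult t)"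
    if a: "a \<in> lprod G X Y" and t: "t \<in> tensor (ladd G) (lmul G) X B Y" for a t
  proof -
    let ?z = "lrep t"
    let ?c = "\<lambda>p. of_int (Poly_Mapping.lookup ?z p) :: 'r"
    have a': "a \<in> LPA G"
      using a A by blast
    have p: "fst p \<in> X" "snd p \<in> Y" if "p \<in> Poly_Mapping.keys ?z" for p
      using that rep[OF t] by (auto simp: fsums_def)
    have "tmult (tlact (ladd G) (lmul G) X B Y a t)
        = lcls G (\<Sum>p\<in>Poly_Mapping.keys ?z. fsc (?c p) (fmul (lrep (lmul G a (fst p))) (lrep (snd p))))"
      unfolding tlact_def using p AX[OF a]
      by (subst tmult_tcls[OF LPA]) (auto simp: tev_sum intro!: fsums_sum fsums_single)
    also have "\<dots> = lcls G (\<Sum>p\<in>Poly_Mapping.keys ?z.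
        fsc (?c p) (fmul (lrep a) (fmul (lrep (fst p)) (lrep (snd p)))))"
    \<comment> \<open>The representative of a product is only congruent to the product of
      representatives, so the two sums are compared term by term modulo the ideal.\<close>
    proof (rule lcls_eqI, unfold sum_subtractf[symmetric] fsc_diff[symmetric], intro lideal_sum lideal_fsc)
      fix q assume q: "q \<in> Poly_Mapping.keys ?z"
      have m: "fst q \<in> LPA G" "snd q \<in> LPA G"
        using p[OF q] LPA by auto
      have "lmul G (lmul G a (fst q)) (snd q) = lmul G (lcls G (lrep a)) (lmul G (fst q) (snd q))"
        using m a' by (simp add: lmul_assoc LPA_lrep)
      also have "\<dots> = lcls G (fmul (lrep a) (fmul (lrep (fst q)) (lrep (snd q))))"
        unfolding lmul_def[of G "fst q"] using m a' by (intro lmul_lcls fmul_lrep_free_alg LPA_lrep)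
      finally show "fmul (lrep (lmul G a (fst q))) (lrep (snd q))
          - fmul (lrep a) (fmul (lrep (fst q)) (lrep (snd q))) \<in> lideal G"
        unfolding lmul_def[of G "lmul G a (fst q)"] using m a' by (intro lcls_fmul_lrep_eqD) auto
    qed
    also have "\<dots> = lcls G (fmul (lrep a) (tev ?z))"
      by (simp add: tev_def fmul_sum_right fmul_fsc_right)
    also have "\<dots> = lmul G a (tmult t)"
      unfolding tmult_def using lmul_lcls[OF LPA_lrep(1)[OF a'] rep_free[OF t]] a'
      by (simp add: LPA_lrep)
    finally show ?thesis .
  qed
  have right: "tmult (tract (ladd G) (lmul G) X B Y t a) = lmul G (tmult t) a"
    if a: "a \<in> lprod G X Y" and t: "t \<in> tensor (ladd G) (lmul G) X B Y" for a t
  proof -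
    let ?z = "lrep t"
    let ?c = "\<lambda>p. of_int (Poly_Mapping.lookup ?z p) :: 'r"
    have a': "a \<in> LPA G"
      using a A by blast
    have p: "fst p \<in> X" "snd p \<in> Y" if "p \<in> Poly_Mapping.keys ?z" for p
      using that rep[OF t] by (auto simp: fsums_def)
    have "tmult (tract (ladd G) (lmul G) X B Y t a)
        = lcls G (\<Sum>p\<in>Poly_Mapping.keys ?z. fsc (?c p) (fmul (lrep (fst p)) (lrep (lmul G (snd p) a))))"
      unfolding tract_def using p YA[OF a]
      by (subst tmult_tcls[OF LPA]) (auto simp: tev_sum intro!: fsums_sum fsums_single)
    also have "\<dots> = lcls G (\<Sum>p\<in>Poly_Mapping.keys ?z.
        fsc (?c p) (fmul (fmul (lrep (fst p)) (lrep (snd p))) (lrep a)))"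
    proof (rule lcls_eqI, unfold sum_subtractf[symmetric] fsc_diff[symmetric], intro lideal_sum lideal_fsc)
      fix q assume q: "q \<in> Poly_Mapping.keys ?z"
      have m: "fst q \<in> LPA G" "snd q \<in> LPA G"
        using p[OF q] LPA by auto
      have "lmul G (fst q) (lmul G (snd q) a) = lmul G (lmul G (fst q) (snd q)) (lcls G (lrep a))"
        using m a' by (simp add: lmul_assoc LPA_lrep)
      also have "\<dots> = lcls G (fmul (fmul (lrep (fst q)) (lrep (snd q))) (lrep a))"
        unfolding lmul_def[of G "fst q"] using m a' by (intro lmul_lcls fmul_lrep_free_alg LPA_lrep)
      finally show "fmul (lrep (fst q)) (lrep (lmul G (snd q) a))
          - fmul (fmul (lrep (fst q)) (lrep (snd q))) (lrep a) \<in> lideal G"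
        unfolding lmul_def[of G "fst q" "lmul G (snd q) a"] using m a'
        by (intro lcls_fmul_lrep_eqD) auto
    qed
    also have "\<dots> = lcls G (fmul (tev ?z) (lrep a))"
      by (simp add: tev_def fmul_sum_left fmul_fsc_left)
    also have "\<dots> = lmul G (tmult t) a"
      unfolding tmult_def using lmul_lcls[OF rep_free[OF t] LPA_lrep(1)[OF a']] a'
      by (simp add: LPA_lrep)
    finally show ?thesis .
  qed
  have "tmult t \<in> lprod G X Y" if "t \<in> tensor (ladd G) (lmul G) X B Y" for t
    unfolding tmult_def using LPA rep[OF that] by (intro lcls_tev_lprod)
  then show ?thesis
    unfolding tensor_mult_hom_def using add left right tmult_tens[OF LPA]
    by (intro conjI ballI subsetI) auto
qed

lemma tmult_surj:
  assumes LPA: "X \<subseteq> LPA G" "B \<subseteq> LPA G" "Y \<subseteq> LPA G"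
    and sc: "\<And>c x. x \<in> X \<Longrightarrow> lsc G c x \<in> X"
  shows "tmult ` tensor (ladd G) (lmul G) X B Y = lprod G X Y"
proof -
  \<comment> \<open>Replacing tensor classes by formal sums lets preimages be built without
    reference to chosen representatives.\<close>
  have "tmult ` tensor (ladd G) (lmul G) X B Y = (\<lambda>z. lcls G (tev z)) ` fsums X Y"
    unfolding tensor_def image_image using tmult_tcls[OF LPA] by (intro image_cong) auto
  moreover have "(\<lambda>z. lcls G (tev z)) ` fsums X Y \<subseteq> lprod G X Y"
    using lcls_tev_lprod LPA by auto
  moreover have "x \<in> (\<lambda>z. lcls G (tev z)) ` fsums X Y" if x: "x \<in> lprod G X Y" for x
  proof -
    let ?S = "{lmul G a b |a b. a \<in> X \<and> b \<in> Y}"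
    have S: "?S \<subseteq> LPA G"
      using LPA by (intro products_LPA)
    \<comment> \<open>Tensors carry only an additive structure, so scalars have to be pushed into the left factor;
       quantifying over all scalars makes this survive the induction.\<close>
    have "\<forall>c. lsc G c x \<in> (\<lambda>z. lcls G (tev z)) ` fsums X Y"
      using x unfolding lprod_def
    proof (induction rule: lspan.induct)
      case lspan_zero
      have "0 \<in> fsums X Y"
        by (simp add: fsums_def)
      then show ?case
        by (auto simp: lzero_def[symmetric] intro!: image_eqI[where x = 0])
    next
      case (lspan_gen x)
      then obtain a b where ab: "x = lmul G a b" "a \<in> X" "b \<in> Y"
        by auto
      show ?case
      proof
        fix c
        have "lsc G c x = lmul G (lsc G c a) b"
          using ab LPA by (subst lmul_sc_left) auto
        then show "lsc G c x \<in> (\<lambda>z. lcls G (tev z)) ` fsums X Y"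
          using ab sc
          by (intro image_eqI[where x = "Poly_Mapping.single (lsc G c a, b) 1"])
            (simp_all add: lmul_def fsums_single)
      qed
    next
      case (lspan_add x y)
      show ?case
      proof
        fix c
        obtain u v where uv: "u \<in> fsums X Y" "lsc G c x = lcls G (tev u)"
          "v \<in> fsums X Y" "lsc G c y = lcls G (tev v)"
          using lspan_add.IH by blast
        have "lsc G c (ladd G x y) = lcls G (tev (u + v))"
          using lspan_add.hyps lspan_LPA[OF _ S] uv LPA
          by (simp add: lsc_add tev_add ladd_lcls tev_free_alg)
        then show "lsc G c (ladd G x y) \<in> (\<lambda>z. lcls G (tev z)) ` fsums X Y"
          using uv fsums_add by blast
      qed
    next
      case (lspan_sc x c)
      then show ?case
        using lspan_LPA[OF _ S] by (simp add: lsc_lsc)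
    qed
    then have "lsc G 1 x \<in> (\<lambda>z. lcls G (tev z)) ` fsums X Y"
      by blast
    moreover have "x \<in> LPA G"
      using x S unfolding lprod_def by (rule lspan_LPA)
    ultimately show ?thesis
      by (simp add: lsc_one)
  qed
  ultimately show ?thesis
    by (intro equalityI subsetI) (simp_all add: subset_iff)
qed

section \<open>Bimodules and the Morita context\<close>

lemma is_bimodI:
  assumes "A \<subseteq> LPA G" "B \<subseteq> LPA G" "S \<subseteq> LPA G"
    and "\<And>a x. a \<in> A \<Longrightarrow> x \<in> lspan G S \<Longrightarrow> lmul G a x \<in> lspan G S"
    and "\<And>b x. b \<in> B \<Longrightarrow> x \<in> lspan G S \<Longrightarrow> lmul G x b \<in> lspan G S"
  shows "is_bimod (ladd G) (lmul G) (lzero G) (lneg G) A B (lspan G S)"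
proof -
  have X: "x \<in> LPA G" if "x \<in> lspan G S" for x
    using that assms(3) by (rule lspan_LPA)
  show ?thesis
    \<comment> \<open>Apart from the two action closures, which are hypotheses, the axioms are
      inherited from the algebra laws or are span closure; negation is scaling by -1.\<close>
    unfolding is_bimod_def
    by (intro conjI ballI; (rule ladd_commute)?)
      (use assms(1,2) in \<open>simp_all add: X subset_iff lneg_def assms(4,5) lmul_assoc lmul_add_left
        lmul_add_right ladd_assoc ladd_zero_left ladd_neg_left[unfolded lneg_def] lspan.intros\<close>)
qed

lemma is_subalgebra_lspanI:
  assumes "S \<subseteq> LPA G" "\<And>x y. x \<in> lspan G S \<Longrightarrow> y \<in> lspan G S \<Longrightarrow> lmul G x y \<in> lspan G S"
  shows "is_subalgebra G (lspan G S)"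
  unfolding is_subalgebra_def using assms
  by (intro conjI ballI allI subsetI) (simp_all add: lspan.intros lspan_LPA)

text \<open>The engine is that \<open>M\<close> is a right ideal and \<open>M*\<close> a left ideal,
  so \<open>M*M\<close> is two-sided. Every inclusion then comes from the product lemma for monomial
  spans or from the idempotents \<open>p_v\<close> with \<open>v\<close> in
  \<open>V\<close>.\<close>

lemma morita_monomials:
  assumes "V \<subseteq> verts G"
  defines "M \<equiv> lspan G (monomials V UNIV)" and "Ms \<equiv> lspan G (monomials UNIV V)"
  shows "is_subalgebra G (lprod G M Ms)"
    and "lprod G M Ms = lspan G (monomials V V)"
    and "is_ideal G (lprod G Ms M)"
    and "lprod G M Ms \<subseteq> lprod G Ms M"
    and "is_bimod (ladd G) (lmul G) (lzero G) (lneg G) (lprod G M Ms) (lprod G Ms M) M"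
    and "is_bimod (ladd G) (lmul G) (lzero G) (lneg G) (lprod G Ms M) (lprod G M Ms) Ms"
    and "surj_morita_context (ladd G) (lmul G) (lprod G M Ms) (lprod G Ms M) M Ms tmult tmult"
proof -
  have LPA: "M \<subseteq> LPA G" "Ms \<subseteq> LPA G"
    unfolding M_def Ms_def by (auto intro: lspan_LPA[OF _ monomials_LPA])
  have prod_LPA: "lprod G M Ms \<subseteq> LPA G" "lprod G Ms M \<subseteq> LPA G"
    using LPA by (simp_all add: lprod_LPA)
  \<comment> \<open>The product lemma applies because the whole algebra is the span of monomials
    with unrestricted ranges.\<close>
  have M_LPA: "lmul G x a \<in> M" if "x \<in> M" "a \<in> LPA G" for x a
    using that unfolding M_def LPA_eq_lspan_monomials by (rule lmul_lspan_monomials)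
  have LPA_Ms: "lmul G a x \<in> Ms" if "x \<in> Ms" "a \<in> LPA G" for x a
    using that unfolding Ms_def LPA_eq_lspan_monomials by (intro lmul_lspan_monomials)
  have mono: "lspan G (monomials V V) \<subseteq> M" "lspan G (monomials V V) \<subseteq> Ms"
    unfolding M_def Ms_def by (auto elim: lspan_monomials_mono)
  have Pv: "wcls [Pv v] \<in> M" "wcls [Pv v] \<in> Ms" if "v \<in> verts G" "v \<in> V" for v
    unfolding M_def Ms_def using that by (auto intro: lspan.lspan_gen Pv_monomials)
  \<comment> \<open>Stated for arbitrary factors, as it is used in both orders: for
    \<open>MM*\<close> itself and for its inclusion in \<open>M*M\<close>. Both are possible since
    \<open>p_v\<close> lies in \<open>M\<close> and in \<open>M*\<close>.\<close>
  have sub: "lspan G (monomials V V) \<subseteq> lprod G M' Ms'"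
    if "\<And>v. v \<in> verts G \<Longrightarrow> v \<in> V \<Longrightarrow> wcls [Pv v] \<in> M'" "lspan G (monomials V V) \<subseteq> Ms'" for M' Ms'
  proof
    fix x assume "x \<in> lspan G (monomials V V)"
    then show "x \<in> lprod G M' Ms'"
      unfolding lprod_def
    proof (rule lspan_subset, intro subsetI)
      fix s assume s: "s \<in> monomials V V"
      then obtain v where v: "v \<in> verts G" "v \<in> V" "lmul G (wcls [Pv v]) s = s"
        by (rule Pv_lmul_monomial)
      have "s \<in> Ms'"
        using s that(2) lspan.lspan_gen by blast
      then have "lmul G (wcls [Pv v]) s \<in> {lmul G a b |a b. a \<in> M' \<and> b \<in> Ms'}"
        using that(1) v by blast
      then show "s \<in> lspan G {lmul G a b |a b. a \<in> M' \<and> b \<in> Ms'}"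
        unfolding v(3) by (rule lspan.lspan_gen)
    qed
  qed
  show MMs: "lprod G M Ms = lspan G (monomials V V)"
  proof
    show "lprod G M Ms \<subseteq> lspan G (monomials V V)"
    proof
      fix x assume "x \<in> lprod G M Ms"
      then show "x \<in> lspan G (monomials V V)"
        unfolding lprod_def by (rule lspan_subset) (auto simp: M_def Ms_def intro: lmul_lspan_monomials)
    qed
  qed (rule sub[OF Pv(1) mono(2)])
  show "lprod G M Ms \<subseteq> lprod G Ms M"
    unfolding MMs by (rule sub[OF Pv(2) mono(1)])
  show "is_subalgebra G (lprod G M Ms)"
    unfolding MMs
  proof (rule is_subalgebra_lspanI[OF monomials_LPA])
    fix x y assume "x \<in> lspan G (monomials V V)" "y \<in> lspan G (monomials V V)"
    then show "lmul G x y \<in> lspan G (monomials V V)"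
      using mono unfolding M_def Ms_def by (blast intro: lmul_lspan_monomials)
  qed
  let ?S = "{lmul G a b |a b. a \<in> Ms \<and> b \<in> M}"
  have S: "?S \<subseteq> LPA G"
    using LPA by (intro products_LPA)
  have ideal: "lmul G a x \<in> lprod G Ms M" "lmul G x a \<in> lprod G Ms M"
    if a: "a \<in> LPA G" and x: "x \<in> lprod G Ms M" for a x
  proof -
    show "lmul G a x \<in> lprod G Ms M"
      unfolding lprod_def
    proof (rule lmul_lspan_right[OF x[unfolded lprod_def] S a])
      fix s assume "s \<in> ?S"
      then obtain n m where nm: "s = lmul G n m" "n \<in> Ms" "m \<in> M"
        by auto
      then have "lmul G a s = lmul G (lmul G a n) m"
        using a LPA by (subst lmul_assoc) auto
      then show "lmul G a s \<in> lspan G ?S"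
        using LPA_Ms[OF nm(2) a] nm(3) by (auto intro: lspan.lspan_gen)
    qed
    show "lmul G x a \<in> lprod G Ms M"
      unfolding lprod_def
    proof (rule lmul_lspan_left[OF x[unfolded lprod_def] S a])
      fix s assume "s \<in> ?S"
      then obtain n m where nm: "s = lmul G n m" "n \<in> Ms" "m \<in> M"
        by auto
      then have "lmul G s a = lmul G n (lmul G m a)"
        using a LPA by (subst lmul_assoc[symmetric]) auto
      then show "lmul G s a \<in> lspan G ?S"
        using M_LPA[OF nm(3) a] nm(2) by (auto intro: lspan.lspan_gen)
    qed
  qed
  have "is_subalgebra G (lprod G Ms M)"
    unfolding lprod_def
    by (rule is_subalgebra_lspanI[OF S]) (use ideal prod_LPA in \<open>auto simp: lprod_def\<close>)
  then show "is_ideal G (lprod G Ms M)"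
    unfolding is_ideal_def using ideal by blast
  \<comment> \<open>Although \<open>M\<close> is only a right ideal, \<open>MM*\<close> acts on it
    from the left: \<open>MM*\<close> lies inside \<open>M\<close>, so \<open>x\<close> can be
    regarded as the right multiplier.\<close>
  have MMs_M: "lmul G a x \<in> M" if "a \<in> lprod G M Ms" "x \<in> M" for a x
    using that mono(1) M_LPA LPA unfolding MMs by blast
  have Ms_MMs: "lmul G x a \<in> Ms" if "a \<in> lprod G M Ms" "x \<in> Ms" for a x
    using that mono(2) LPA_Ms LPA unfolding MMs by blast
  have M_MsM: "lmul G x b \<in> M" if "b \<in> lprod G Ms M" "x \<in> M" for b x
    using that M_LPA prod_LPA by blast
  have MsM_Ms: "lmul G b x \<in> Ms" if "b \<in> lprod G Ms M" "x \<in> Ms" for b x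
    using that LPA_Ms prod_LPA by blast
  show "is_bimod (ladd G) (lmul G) (lzero G) (lneg G) (lprod G M Ms) (lprod G Ms M) M"
    using prod_LPA monomials_LPA MMs_M M_MsM unfolding M_def by (intro is_bimodI) auto
  show "is_bimod (ladd G) (lmul G) (lzero G) (lneg G) (lprod G Ms M) (lprod G M Ms) Ms"
    using prod_LPA monomials_LPA MsM_Ms Ms_MMs unfolding Ms_def by (intro is_bimodI) auto
  have Psi: "tensor_mult_hom (ladd G) (lmul G) (lprod G M Ms) M (lprod G Ms M) Ms tmult"
    using LPA prod_LPA MMs_M Ms_MMs by (intro tensor_mult_hom_tmult)
  have Phi: "tensor_mult_hom (ladd G) (lmul G) (lprod G Ms M) Ms (lprod G M Ms) M tmult"
    using LPA prod_LPA MsM_Ms M_MsM by (intro tensor_mult_hom_tmult)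
  have sc: "lsc G c x \<in> M" if "x \<in> M" for c x
    using that unfolding M_def by (rule lspan.lspan_sc)
  have sc': "lsc G c x \<in> Ms" if "x \<in> Ms" for c x
    using that unfolding Ms_def by (rule lspan.lspan_sc)
  show "surj_morita_context (ladd G) (lmul G) (lprod G M Ms) (lprod G Ms M) M Ms tmult tmult"
    unfolding surj_morita_context_def
  proof (intro conjI ballI)
    show "tmult ` tensor (ladd G) (lmul G) M (lprod G Ms M) Ms = lprod G M Ms"
      using LPA prod_LPA sc by (intro tmult_surj)
    show "tmult ` tensor (ladd G) (lmul G) Ms (lprod G M Ms) M = lprod G Ms M"
      using LPA prod_LPA sc' by (intro tmult_surj)
  \<comment> \<open>On elementary tensors both maps are multiplication, so the two compatibility
    identities are associativity.\<close>
  qed (use Psi Phi LPA prod_LPA in \<open>simp_all add: tmult_tens lmul_assoc subset_iff\<close>)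
qed

end

theorem theorem3p1:
  fixes G :: "('v,'e) dgraph" and V :: "'v set"
    and M Ms MMs MsM :: "('v,'e,'r::comm_ring_1) lelem set"
  assumes "wf_graph G" and "V \<subseteq> verts G"
    and "M = Mleft G V" and "Ms = Mright G V"
    and "MMs = lprod G M Ms" and "MsM = lprod G Ms M"
  shows "is_subalgebra G MMs \<and>
      MMs = lspan G {lmul G (spath G \<mu>) (spath_star G \<nu>) | \<mu> \<nu>.
                 is_path G \<mu> \<and> is_path G \<nu> \<and> prange G \<mu> \<in> V \<and> prange G \<nu> \<in> V} \<and>
      is_ideal G MsM \<and> MMs \<subseteq> MsM \<and>
      is_bimod (ladd G) (lmul G) (lzero G) (lneg G) MMs MsM M \<and>
      is_bimod (ladd G) (lmul G) (lzero G) (lneg G) MsM MMs Ms \<and>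
      (\<exists>Psi Phi. surj_morita_context (ladd G) (lmul G) MMs MsM M Ms Psi Phi)"
proof -
  interpret leavitt_graph G "TYPE('r)"
    by unfold_locales (rule assms(1))
  \<comment> \<open>A path range lies in \<open>UNIV\<close> trivially, so the one-sided conditions
    defining \<open>M\<close> and \<open>M*\<close> are instances of the two-parameter
    family.\<close>
  have M: "M = lspan G (monomials V UNIV)"
    unfolding assms(3) Mleft_def by (simp flip: monomials_eq)
  have Ms: "Ms = lspan G (monomials UNIV V)"
    unfolding assms(4) Mright_def by (simp flip: monomials_eq)
  show ?thesis
    unfolding assms(5,6) monomials_eq M Ms
    using morita_monomials[OF assms(2)] by blast
qed

end
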